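(* It is provable in $\mathbf{ZF}$ that $\mathbf{WDC}$ implies that every regular $P$-space is zero-dimensional, so also completely regular. In consequence, $\mathbf{WDC}$ implies that every regular $P$-space is strongly zero-dimensional, and that a regular $P$-space is zero-dimensional if and only if it is completely regular.
   Context: The base theory is $\mathbf{ZF}$ (no Axiom of Choice). $\mathbf{WDC}$ (Principle of Weak Dependent Choices): if $R$ is a binary relation on a set $E$ such that $(\forall x\in E)(\exists y\in E)\,\langle x,y\rangle\in R$, then there exists a sequence $(F_n)_{n\in\omega}$ of non-empty finite subsets of $E$ such that $(\forall n\in\omega)(\forall x\in F_n)(\exists y\in F_{n+1})\,\langle x,y\rangle\in R$. (As usual, $E$ is understood to be non-empty.) A topological space is a $P$-space if all its $G_\delta$-sets are open. $\mathbf{X}$ is regular if for every point $x$ and open $V\ni x$ there is an open $U$ with $x\in U$ and $\mathrm{cl}_{\mathbf{X}}(U)\subseteq V$ (no $T_1$ assumed). $\mathbf{X}$ is zero-dimensional if its clopen sets form a base. A zero-set is a set $f^{-1}[\{0\}]$ with $f:\mathbf{X}\to\mathbb{R}$ continuous. $\mathbf{X}$ is completely regular if complements of zero-sets form a base. $\mathbf{X}$ is strongly zero-dimensional if it is completely regular and for every pair $Z_1,Z_2$ of disjoint zero-sets there is a clopen set $U$ with $Z_1\subseteq U\subseteq X\setminus Z_2$. *)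

theory Defs
  imports Main
begin

text \<open>
  The base theory is ZF without choice, whereas HOL itself has a choice operator; a shallow
  rendering would make weak dependent choice a theorem of the metatheory.  Hence ZF is
  formalized as a first-order theory, and provability is derivability in classical natural
  deduction with equality.
\<close>

section \<open>First-order logic in the language of set theory\<close>

text \<open>Variables are de Bruijn indices; they are the only terms.\<close>

datatype fm = Fls | Eq nat nat | Mem nat nat | Imp fm fm | All fm

primrec ren :: "(nat \<Rightarrow> nat) \<Rightarrow> fm \<Rightarrow> fm" where
  "ren r Fls = Fls"
| "ren r (Eq i j) = Eq (r i) (r j)"
| "ren r (Mem i j) = Mem (r i) (r j)"
| "ren r (Imp p q) = Imp (ren r p) (ren r q)"
| "ren r (All p) = All (ren (case_nat 0 (\<lambda>i. Suc (r i))) p)"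

definition shift :: "fm \<Rightarrow> fm" where
  "shift = ren Suc"

text \<open>\<open>inst t p\<close> replaces index 0 of \<open>p\<close> by \<open>t\<close> and lowers the other free indices by one.\<close>

definition inst :: "nat \<Rightarrow> fm \<Rightarrow> fm" where
  "inst t = ren (case_nat t (\<lambda>i. i))"

text \<open>\<open>closed_fm n p\<close>: all free indices of \<open>p\<close> are below \<open>n\<close>.\<close>

primrec closed_fm :: "nat \<Rightarrow> fm \<Rightarrow> bool" where
  "closed_fm n Fls \<longleftrightarrow> True"
| "closed_fm n (Eq i j) \<longleftrightarrow> i < n \<and> j < n"
| "closed_fm n (Mem i j) \<longleftrightarrow> i < n \<and> j < n"
| "closed_fm n (Imp p q) \<longleftrightarrow> closed_fm n p \<and> closed_fm n q"
| "closed_fm n (All p) \<longleftrightarrow> closed_fm (Suc n) p"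

text \<open>In \<open>AllI\<close>, shifting the hypotheses makes index 0 the eigenvariable.\<close>

inductive derives :: "fm set \<Rightarrow> fm \<Rightarrow> bool" (infix \<open>\<turnstile>\<close> 5) where
  Assm: "p \<in> \<Gamma> \<Longrightarrow> \<Gamma> \<turnstile> p"
| ImpI: "insert p \<Gamma> \<turnstile> q \<Longrightarrow> \<Gamma> \<turnstile> Imp p q"
| ImpE: "\<Gamma> \<turnstile> Imp p q \<Longrightarrow> \<Gamma> \<turnstile> p \<Longrightarrow> \<Gamma> \<turnstile> q"
| Class: "insert (Imp p Fls) \<Gamma> \<turnstile> Fls \<Longrightarrow> \<Gamma> \<turnstile> p"
| AllI: "shift ` \<Gamma> \<turnstile> p \<Longrightarrow> \<Gamma> \<turnstile> All p"
| AllE: "\<Gamma> \<turnstile> All p \<Longrightarrow> \<Gamma> \<turnstile> inst t p"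
| EqRefl: "\<Gamma> \<turnstile> Eq t t"
| EqSubst: "\<Gamma> \<turnstile> Eq s t \<Longrightarrow> \<Gamma> \<turnstile> inst s p \<Longrightarrow> \<Gamma> \<turnstile> inst t p"

section \<open>Notation with named variables\<close>

text \<open>
  A \<open>form\<close> yields a formula once the number \<open>k\<close> of enclosing quantifiers is given.  A variable
  is the number of quantifiers enclosing its own binder (a de Bruijn level); below \<open>k\<close>
  quantifiers the variable \<open>x\<close> has the index \<open>k - Suc x\<close>.  Sentences are evaluated at depth 0.
\<close>

type_synonym var = nat
type_synonym form = "nat \<Rightarrow> fm"

definition fMem :: "var \<Rightarrow> var \<Rightarrow> form" (infix \<open>\<^bold>\<in>\<close> 50) where
  "(x \<^bold>\<in> y) = (\<lambda>k. Mem (k - Suc x) (k - Suc y))"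

definition fEq :: "var \<Rightarrow> var \<Rightarrow> form" (infix \<open>\<^bold>=\<close> 50) where
  "(x \<^bold>= y) = (\<lambda>k. Eq (k - Suc x) (k - Suc y))"

definition fImp :: "form \<Rightarrow> form \<Rightarrow> form" (infixr \<open>\<^bold>\<longrightarrow>\<close> 25) where
  "(P \<^bold>\<longrightarrow> Q) = (\<lambda>k. Imp (P k) (Q k))"

definition fNot :: "form \<Rightarrow> form" (\<open>\<^bold>\<not> _\<close> [40] 40) where
  "(\<^bold>\<not> P) = (\<lambda>k. Imp (P k) Fls)"

definition fAnd :: "form \<Rightarrow> form \<Rightarrow> form" (infixr \<open>\<^bold>\<and>\<close> 35) where
  "(P \<^bold>\<and> Q) = (\<^bold>\<not> (P \<^bold>\<longrightarrow> \<^bold>\<not> Q))"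

definition fOr :: "form \<Rightarrow> form \<Rightarrow> form" (infixr \<open>\<^bold>\<or>\<close> 30) where
  "(P \<^bold>\<or> Q) = (\<^bold>\<not> P \<^bold>\<longrightarrow> Q)"

definition fIff :: "form \<Rightarrow> form \<Rightarrow> form" (infixr \<open>\<^bold>\<longleftrightarrow>\<close> 25) where
  "(P \<^bold>\<longleftrightarrow> Q) = ((P \<^bold>\<longrightarrow> Q) \<^bold>\<and> (Q \<^bold>\<longrightarrow> P))"

definition fAll :: "(var \<Rightarrow> form) \<Rightarrow> form" (binder \<open>\<^bold>\<forall>\<close> 10) where
  "fAll P = (\<lambda>k. All (P k (Suc k)))"

definition fEx :: "(var \<Rightarrow> form) \<Rightarrow> form" (binder \<open>\<^bold>\<exists>\<close> 10) where
  "fEx P = (\<^bold>\<not> (\<^bold>\<forall>x. \<^bold>\<not> P x))"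

text \<open>
  Application of an arbitrary de Bruijn formula \<open>p\<close>, as needed for the axiom schemes: its first
  one or two indices are the arguments, and the remaining ones are parameters, bound outside
  all the quantifiers of the notation.
\<close>

definition app1 :: "fm \<Rightarrow> var \<Rightarrow> form" where
  "app1 p x = (\<lambda>k. ren (case_nat (k - Suc x) (\<lambda>j. k + j)) p)"

definition app2 :: "fm \<Rightarrow> var \<Rightarrow> var \<Rightarrow> form" where
  "app2 p x y = (\<lambda>k. ren (case_nat (k - Suc x) (case_nat (k - Suc y) (\<lambda>j. k + j))) p)"

section \<open>Elementary set theory\<close>

definition subset :: "var \<Rightarrow> var \<Rightarrow> form" (infix \<open>\<^bold>\<subseteq>\<close> 50) where
  "(a \<^bold>\<subseteq> b) = (\<^bold>\<forall>x. x \<^bold>\<in> a \<^bold>\<longrightarrow> x \<^bold>\<in> b)"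

definition nonempty :: "var \<Rightarrow> form" where
  "nonempty a = (\<^bold>\<exists>x. x \<^bold>\<in> a)"

definition disjoint :: "var \<Rightarrow> var \<Rightarrow> form" where
  "disjoint a b = (\<^bold>\<not> (\<^bold>\<exists>x. x \<^bold>\<in> a \<^bold>\<and> x \<^bold>\<in> b))"

text \<open>There are no function symbols, so a set-theoretic operation is rendered by its graph:
  \<open>is_diff c a b\<close> says that \<open>c\<close> is the difference of \<open>a\<close> and \<open>b\<close>, and so on.\<close>

definition is_upair :: "var \<Rightarrow> var \<Rightarrow> var \<Rightarrow> form" where
  "is_upair c a b = (\<^bold>\<forall>x. x \<^bold>\<in> c \<^bold>\<longleftrightarrow> x \<^bold>= a \<^bold>\<or> x \<^bold>= b)"

definition is_pair :: "var \<Rightarrow> var \<Rightarrow> var \<Rightarrow> form" where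
  "is_pair p a b = (\<^bold>\<exists>s t. is_upair s a a \<^bold>\<and> is_upair t a b \<^bold>\<and> is_upair p s t)"

definition is_Union :: "var \<Rightarrow> var \<Rightarrow> form" where
  "is_Union u A = (\<^bold>\<forall>x. x \<^bold>\<in> u \<^bold>\<longleftrightarrow> (\<^bold>\<exists>a. a \<^bold>\<in> A \<^bold>\<and> x \<^bold>\<in> a))"

definition is_inter :: "var \<Rightarrow> var \<Rightarrow> var \<Rightarrow> form" where
  "is_inter c a b = (\<^bold>\<forall>x. x \<^bold>\<in> c \<^bold>\<longleftrightarrow> x \<^bold>\<in> a \<^bold>\<and> x \<^bold>\<in> b)"

definition is_diff :: "var \<Rightarrow> var \<Rightarrow> var \<Rightarrow> form" where
  "is_diff c a b = (\<^bold>\<forall>x. x \<^bold>\<in> c \<^bold>\<longleftrightarrow> x \<^bold>\<in> a \<^bold>\<and> \<^bold>\<not> x \<^bold>\<in> b)"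

definition is_succ :: "var \<Rightarrow> var \<Rightarrow> form" where
  "is_succ s n = (\<^bold>\<forall>x. x \<^bold>\<in> s \<^bold>\<longleftrightarrow> x \<^bold>\<in> n \<^bold>\<or> x \<^bold>= n)"

definition successor_closed :: "var \<Rightarrow> form" where
  "successor_closed I =
    ((\<^bold>\<exists>e. e \<^bold>\<in> I \<^bold>\<and> \<^bold>\<not> nonempty e) \<^bold>\<and>
     (\<^bold>\<forall>n. n \<^bold>\<in> I \<^bold>\<longrightarrow> (\<^bold>\<exists>s. s \<^bold>\<in> I \<^bold>\<and> is_succ s n)))"

definition is_omega :: "var \<Rightarrow> form" where
  "is_omega w = (successor_closed w \<^bold>\<and> (\<^bold>\<forall>I. successor_closed I \<^bold>\<longrightarrow> w \<^bold>\<subseteq> I))"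

section \<open>The axioms of ZF\<close>

definition extensionality :: form where
  "extensionality = (\<^bold>\<forall>a b. (\<^bold>\<forall>x. x \<^bold>\<in> a \<^bold>\<longleftrightarrow> x \<^bold>\<in> b) \<^bold>\<longrightarrow> a \<^bold>= b)"

definition foundation :: form where
  "foundation = (\<^bold>\<forall>a. nonempty a \<^bold>\<longrightarrow> (\<^bold>\<exists>x. x \<^bold>\<in> a \<^bold>\<and> disjoint x a))"

definition pairing :: form where
  "pairing = (\<^bold>\<forall>a b. \<^bold>\<exists>c. is_upair c a b)"

definition union_axiom :: form where
  "union_axiom = (\<^bold>\<forall>A. \<^bold>\<exists>u. is_Union u A)"

definition powerset :: form where
  "powerset = (\<^bold>\<forall>a. \<^bold>\<exists>P. \<^bold>\<forall>x. x \<^bold>\<in> P \<^bold>\<longleftrightarrow> x \<^bold>\<subseteq> a)"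

definition infinity :: form where
  "infinity = (\<^bold>\<exists>I. successor_closed I)"

definition separation :: "fm \<Rightarrow> form" where
  "separation p = (\<^bold>\<forall>a. \<^bold>\<exists>b. \<^bold>\<forall>x. x \<^bold>\<in> b \<^bold>\<longleftrightarrow> x \<^bold>\<in> a \<^bold>\<and> app1 p x)"

definition replacement :: "fm \<Rightarrow> form" where
  "replacement p = (\<^bold>\<forall>a.
    (\<^bold>\<forall>x y z. x \<^bold>\<in> a \<^bold>\<and> app2 p x y \<^bold>\<and> app2 p x z \<^bold>\<longrightarrow> y \<^bold>= z) \<^bold>\<longrightarrow>
    (\<^bold>\<exists>b. \<^bold>\<forall>y. y \<^bold>\<in> b \<^bold>\<longleftrightarrow> (\<^bold>\<exists>x. x \<^bold>\<in> a \<^bold>\<and> app2 p x y)))"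

text \<open>The universal closures of a formula.\<close>

definition closures :: "fm \<Rightarrow> fm set" where
  "closures p = {(All ^^ n) p | n. closed_fm n p}"

definition ZF :: "fm set" where
  "ZF = {extensionality 0, foundation 0, pairing 0, union_axiom 0, powerset 0, infinity 0}
        \<union> (\<Union>p. closures (separation p 0)) \<union> (\<Union>p. closures (replacement p 0))"

definition proves :: "fm set \<Rightarrow> form \<Rightarrow> bool" (infix \<open>\<^bold>\<turnstile>\<close> 5) where
  "(\<Gamma> \<^bold>\<turnstile> P) \<longleftrightarrow> (\<Gamma> \<turnstile> P 0)"

section \<open>Relations, functions, finite sets, weak dependent choice\<close>

text \<open>\<open>rel r x y\<close>: the pair of \<open>x\<close> and \<open>y\<close> is in \<open>r\<close>; for a function \<open>r\<close>,
  that \<open>y\<close> is its value at \<open>x\<close>.\<close>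

definition rel :: "var \<Rightarrow> var \<Rightarrow> var \<Rightarrow> form" where
  "rel r x y = (\<^bold>\<exists>p. is_pair p x y \<^bold>\<and> p \<^bold>\<in> r)"

definition relation_on :: "var \<Rightarrow> var \<Rightarrow> form" where
  "relation_on r E = (\<^bold>\<forall>p. p \<^bold>\<in> r \<^bold>\<longrightarrow> (\<^bold>\<exists>x y. x \<^bold>\<in> E \<^bold>\<and> y \<^bold>\<in> E \<^bold>\<and> is_pair p x y))"

definition function_on :: "var \<Rightarrow> var \<Rightarrow> form" where
  "function_on f A =
    ((\<^bold>\<forall>p. p \<^bold>\<in> f \<^bold>\<longrightarrow> (\<^bold>\<exists>x y. x \<^bold>\<in> A \<^bold>\<and> is_pair p x y)) \<^bold>\<and>
     (\<^bold>\<forall>x. x \<^bold>\<in> A \<^bold>\<longrightarrow> (\<^bold>\<exists>y. rel f x y)) \<^bold>\<and>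
     (\<^bold>\<forall>x y z. rel f x y \<^bold>\<and> rel f x z \<^bold>\<longrightarrow> y \<^bold>= z))"

definition function_to :: "var \<Rightarrow> var \<Rightarrow> var \<Rightarrow> form" where
  "function_to f A B = (function_on f A \<^bold>\<and> (\<^bold>\<forall>x y. rel f x y \<^bold>\<longrightarrow> y \<^bold>\<in> B))"

definition bijection :: "var \<Rightarrow> var \<Rightarrow> var \<Rightarrow> form" where
  "bijection f A B =
    (function_to f A B \<^bold>\<and>
     (\<^bold>\<forall>x y z. rel f x z \<^bold>\<and> rel f y z \<^bold>\<longrightarrow> x \<^bold>= y) \<^bold>\<and>
     (\<^bold>\<forall>y. y \<^bold>\<in> B \<^bold>\<longrightarrow> (\<^bold>\<exists>x. rel f x y)))"

definition finite_set :: "var \<Rightarrow> form" where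
  "finite_set A = (\<^bold>\<exists>w n f. is_omega w \<^bold>\<and> n \<^bold>\<in> w \<^bold>\<and> bijection f n A)"

definition WDC :: form where
  "WDC = (\<^bold>\<forall>E R.
    nonempty E \<^bold>\<and> relation_on R E \<^bold>\<and> (\<^bold>\<forall>x. x \<^bold>\<in> E \<^bold>\<longrightarrow> (\<^bold>\<exists>y. y \<^bold>\<in> E \<^bold>\<and> rel R x y)) \<^bold>\<longrightarrow>
    (\<^bold>\<exists>w F. is_omega w \<^bold>\<and> function_on F w \<^bold>\<and>
      (\<^bold>\<forall>n A. n \<^bold>\<in> w \<^bold>\<and> rel F n A \<^bold>\<longrightarrow> nonempty A \<^bold>\<and> finite_set A \<^bold>\<and> A \<^bold>\<subseteq> E) \<^bold>\<and>
      (\<^bold>\<forall>n m A B. n \<^bold>\<in> w \<^bold>\<and> is_succ m n \<^bold>\<and> rel F n A \<^bold>\<and> rel F m B \<^bold>\<longrightarrow>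
        (\<^bold>\<forall>x. x \<^bold>\<in> A \<^bold>\<longrightarrow> (\<^bold>\<exists>y. y \<^bold>\<in> B \<^bold>\<and> rel R x y)))))"

section \<open>Topological spaces\<close>

definition topology :: "var \<Rightarrow> var \<Rightarrow> form" where
  "topology X T =
    ((\<^bold>\<forall>U. U \<^bold>\<in> T \<^bold>\<longrightarrow> U \<^bold>\<subseteq> X) \<^bold>\<and> X \<^bold>\<in> T \<^bold>\<and>
     (\<^bold>\<forall>U V W. U \<^bold>\<in> T \<^bold>\<and> V \<^bold>\<in> T \<^bold>\<and> is_inter W U V \<^bold>\<longrightarrow> W \<^bold>\<in> T) \<^bold>\<and>
     (\<^bold>\<forall>S U. S \<^bold>\<subseteq> T \<^bold>\<and> is_Union U S \<^bold>\<longrightarrow> U \<^bold>\<in> T))"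

definition closed_in :: "var \<Rightarrow> var \<Rightarrow> var \<Rightarrow> form" where
  "closed_in X T C = (C \<^bold>\<subseteq> X \<^bold>\<and> (\<^bold>\<exists>U. U \<^bold>\<in> T \<^bold>\<and> is_diff U X C))"

definition clopen_in :: "var \<Rightarrow> var \<Rightarrow> var \<Rightarrow> form" where
  "clopen_in X T U = (U \<^bold>\<in> T \<^bold>\<and> closed_in X T U)"

text \<open>\<open>is_closure X T C A\<close>: \<open>C\<close> is the closure of \<open>A\<close> in the space.\<close>

definition is_closure :: "var \<Rightarrow> var \<Rightarrow> var \<Rightarrow> var \<Rightarrow> form" where
  "is_closure X T C A =
    (\<^bold>\<forall>x. x \<^bold>\<in> C \<^bold>\<longleftrightarrow> x \<^bold>\<in> X \<^bold>\<and> (\<^bold>\<forall>K. closed_in X T K \<^bold>\<and> A \<^bold>\<subseteq> K \<^bold>\<longrightarrow> x \<^bold>\<in> K))"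

definition is_base :: "var \<Rightarrow> var \<Rightarrow> form" where
  "is_base B T =
    (B \<^bold>\<subseteq> T \<^bold>\<and> (\<^bold>\<forall>U x. U \<^bold>\<in> T \<^bold>\<and> x \<^bold>\<in> U \<^bold>\<longrightarrow> (\<^bold>\<exists>V. V \<^bold>\<in> B \<^bold>\<and> x \<^bold>\<in> V \<^bold>\<and> V \<^bold>\<subseteq> U)))"

definition G_delta :: "var \<Rightarrow> var \<Rightarrow> form" where
  "G_delta T G = (\<^bold>\<exists>w F. is_omega w \<^bold>\<and> function_to F w T \<^bold>\<and>
    (\<^bold>\<forall>x. x \<^bold>\<in> G \<^bold>\<longleftrightarrow> (\<^bold>\<forall>n U. n \<^bold>\<in> w \<^bold>\<and> rel F n U \<^bold>\<longrightarrow> x \<^bold>\<in> U)))"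

definition P_space :: "var \<Rightarrow> var \<Rightarrow> form" where
  "P_space X T = (topology X T \<^bold>\<and> (\<^bold>\<forall>G. G_delta T G \<^bold>\<longrightarrow> G \<^bold>\<in> T))"

definition regular :: "var \<Rightarrow> var \<Rightarrow> form" where
  "regular X T = (topology X T \<^bold>\<and>
    (\<^bold>\<forall>x V. V \<^bold>\<in> T \<^bold>\<and> x \<^bold>\<in> V \<^bold>\<longrightarrow>
      (\<^bold>\<exists>U C. U \<^bold>\<in> T \<^bold>\<and> x \<^bold>\<in> U \<^bold>\<and> is_closure X T C U \<^bold>\<and> C \<^bold>\<subseteq> V)))"

definition zero_dimensional :: "var \<Rightarrow> var \<Rightarrow> form" where
  "zero_dimensional X T = (topology X T \<^bold>\<and>
    (\<^bold>\<exists>B. (\<^bold>\<forall>U. U \<^bold>\<in> B \<^bold>\<longleftrightarrow> clopen_in X T U) \<^bold>\<and> is_base B T))"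

section \<open>The real line\<close>

definition operation_on :: "var \<Rightarrow> var \<Rightarrow> form" where
  "operation_on f A = (\<^bold>\<exists>D. (\<^bold>\<forall>p. p \<^bold>\<in> D \<^bold>\<longleftrightarrow> (\<^bold>\<exists>x y. x \<^bold>\<in> A \<^bold>\<and> y \<^bold>\<in> A \<^bold>\<and> is_pair p x y)) \<^bold>\<and>
    function_to f D A)"

text \<open>\<open>op f x y z\<close>: the value of the binary operation \<open>f\<close> at \<open>x\<close> and \<open>y\<close> is \<open>z\<close>.\<close>

definition op :: "var \<Rightarrow> var \<Rightarrow> var \<Rightarrow> var \<Rightarrow> form" where
  "op f x y z = (\<^bold>\<exists>p. is_pair p x y \<^bold>\<and> rel f p z)"

definition assoc_comm_unit :: "var \<Rightarrow> var \<Rightarrow> var \<Rightarrow> form" where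
  "assoc_comm_unit A f e =
    (operation_on f A \<^bold>\<and> e \<^bold>\<in> A \<^bold>\<and>
     (\<^bold>\<forall>x y z u v s t. op f x y u \<^bold>\<and> op f u z s \<^bold>\<and> op f y z v \<^bold>\<and> op f x v t \<^bold>\<longrightarrow> s \<^bold>= t) \<^bold>\<and>
     (\<^bold>\<forall>x y u. op f x y u \<^bold>\<longrightarrow> op f y x u) \<^bold>\<and>
     (\<^bold>\<forall>x. x \<^bold>\<in> A \<^bold>\<longrightarrow> op f e x x))"

text \<open>\<open>add\<close>, \<open>mul\<close> and \<open>lt\<close> are the operations and the strict order.\<close>

definition ordered_field :: "var \<Rightarrow> var \<Rightarrow> var \<Rightarrow> var \<Rightarrow> var \<Rightarrow> var \<Rightarrow> form" where
  "ordered_field A add mul zero one lt =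
    (assoc_comm_unit A add zero \<^bold>\<and> assoc_comm_unit A mul one \<^bold>\<and> \<^bold>\<not> zero \<^bold>= one \<^bold>\<and>
     (\<^bold>\<forall>x. x \<^bold>\<in> A \<^bold>\<longrightarrow> (\<^bold>\<exists>y. y \<^bold>\<in> A \<^bold>\<and> op add x y zero)) \<^bold>\<and>
     (\<^bold>\<forall>x. x \<^bold>\<in> A \<^bold>\<and> \<^bold>\<not> x \<^bold>= zero \<^bold>\<longrightarrow> (\<^bold>\<exists>y. y \<^bold>\<in> A \<^bold>\<and> op mul x y one)) \<^bold>\<and>
     (\<^bold>\<forall>x y z u v r s t. op add y z u \<^bold>\<and> op mul x u v \<^bold>\<and>
        op mul x y r \<^bold>\<and> op mul x z s \<^bold>\<and> op add r s t \<^bold>\<longrightarrow> v \<^bold>= t) \<^bold>\<and>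
     relation_on lt A \<^bold>\<and>
     (\<^bold>\<forall>x. \<^bold>\<not> rel lt x x) \<^bold>\<and>
     (\<^bold>\<forall>x y z. rel lt x y \<^bold>\<and> rel lt y z \<^bold>\<longrightarrow> rel lt x z) \<^bold>\<and>
     (\<^bold>\<forall>x y. x \<^bold>\<in> A \<^bold>\<and> y \<^bold>\<in> A \<^bold>\<longrightarrow> rel lt x y \<^bold>\<or> x \<^bold>= y \<^bold>\<or> rel lt y x) \<^bold>\<and>
     (\<^bold>\<forall>x y z u v. rel lt x y \<^bold>\<and> op add x z u \<^bold>\<and> op add y z v \<^bold>\<longrightarrow> rel lt u v) \<^bold>\<and>
     (\<^bold>\<forall>x y u. rel lt zero x \<^bold>\<and> rel lt zero y \<^bold>\<and> op mul x y u \<^bold>\<longrightarrow> rel lt zero u))"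

definition upper_bound :: "var \<Rightarrow> var \<Rightarrow> var \<Rightarrow> var \<Rightarrow> form" where
  "upper_bound A lt S b = (b \<^bold>\<in> A \<^bold>\<and> (\<^bold>\<forall>x. x \<^bold>\<in> S \<^bold>\<longrightarrow> rel lt x b \<^bold>\<or> x \<^bold>= b))"

definition complete_order :: "var \<Rightarrow> var \<Rightarrow> form" where
  "complete_order A lt =
    (\<^bold>\<forall>S. S \<^bold>\<subseteq> A \<^bold>\<and> nonempty S \<^bold>\<and> (\<^bold>\<exists>b. upper_bound A lt S b) \<^bold>\<longrightarrow>
      (\<^bold>\<exists>b. upper_bound A lt S b \<^bold>\<and> (\<^bold>\<forall>c. upper_bound A lt S c \<^bold>\<longrightarrow> rel lt b c \<^bold>\<or> b \<^bold>= c)))"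

text \<open>
  ZF proves that a Dedekind complete ordered field exists and is unique up to isomorphism.
  The notions depending on the reals take such a field as a parameter.
\<close>

definition is_reals :: "var \<Rightarrow> var \<Rightarrow> var \<Rightarrow> var \<Rightarrow> var \<Rightarrow> var \<Rightarrow> form" where
  "is_reals A add mul zero one lt =
    (ordered_field A add mul zero one lt \<^bold>\<and> complete_order A lt)"

definition open_interval :: "var \<Rightarrow> var \<Rightarrow> var \<Rightarrow> var \<Rightarrow> form" where
  "open_interval lt I a b = (\<^bold>\<forall>x. x \<^bold>\<in> I \<^bold>\<longleftrightarrow> rel lt a x \<^bold>\<and> rel lt x b)"

definition open_reals :: "var \<Rightarrow> var \<Rightarrow> var \<Rightarrow> form" where
  "open_reals A lt V = (V \<^bold>\<subseteq> A \<^bold>\<and>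
    (\<^bold>\<forall>y. y \<^bold>\<in> V \<^bold>\<longrightarrow> (\<^bold>\<exists>a b I. open_interval lt I a b \<^bold>\<and> y \<^bold>\<in> I \<^bold>\<and> I \<^bold>\<subseteq> V)))"

definition is_preimage :: "var \<Rightarrow> var \<Rightarrow> var \<Rightarrow> form" where
  "is_preimage U f V = (\<^bold>\<forall>x. x \<^bold>\<in> U \<^bold>\<longleftrightarrow> (\<^bold>\<exists>y. y \<^bold>\<in> V \<^bold>\<and> rel f x y))"

definition continuous_to_reals :: "var \<Rightarrow> var \<Rightarrow> var \<Rightarrow> var \<Rightarrow> var \<Rightarrow> form" where
  "continuous_to_reals A lt X T f = (function_to f X A \<^bold>\<and>
    (\<^bold>\<forall>V U. open_reals A lt V \<^bold>\<and> is_preimage U f V \<^bold>\<longrightarrow> U \<^bold>\<in> T))"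

definition zero_set :: "var \<Rightarrow> var \<Rightarrow> var \<Rightarrow> var \<Rightarrow> var \<Rightarrow> var \<Rightarrow> form" where
  "zero_set A zero lt X T Z = (\<^bold>\<exists>f. continuous_to_reals A lt X T f \<^bold>\<and>
    (\<^bold>\<forall>x. x \<^bold>\<in> Z \<^bold>\<longleftrightarrow> rel f x zero))"

definition completely_regular :: "var \<Rightarrow> var \<Rightarrow> var \<Rightarrow> var \<Rightarrow> var \<Rightarrow> form" where
  "completely_regular A zero lt X T = (topology X T \<^bold>\<and>
    (\<^bold>\<exists>B. (\<^bold>\<forall>U. U \<^bold>\<in> B \<^bold>\<longleftrightarrow> (\<^bold>\<exists>Z. zero_set A zero lt X T Z \<^bold>\<and> is_diff U X Z)) \<^bold>\<and> is_base B T))"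

definition strongly_zero_dimensional :: "var \<Rightarrow> var \<Rightarrow> var \<Rightarrow> var \<Rightarrow> var \<Rightarrow> form" where
  "strongly_zero_dimensional A zero lt X T = (completely_regular A zero lt X T \<^bold>\<and>
    (\<^bold>\<forall>Z Z'. zero_set A zero lt X T Z \<^bold>\<and> zero_set A zero lt X T Z' \<^bold>\<and> disjoint Z Z' \<^bold>\<longrightarrow>
      (\<^bold>\<exists>U D. clopen_in X T U \<^bold>\<and> is_diff D X Z' \<^bold>\<and> Z \<^bold>\<subseteq> U \<^bold>\<and> U \<^bold>\<subseteq> D)))"

end

(*
  By Henkin's completeness theorem it suffices to verify the four sentences in every model of ZF on
  the natural numbers. For regularity, apply WDC to the open neighbourhoods of a point x inside V
  and the relation "the closure of U' is contained in U". The union D of the resulting finite sets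
  satisfies: every U in D contains the closure of some U' in D. Hence the intersection of D is
  closed, and it is open because in a P-space countable intersections of finite intersections of
  open sets are open; so it is a clopen neighbourhood of x inside V. Characteristic functions of
  clopen sets then give complete regularity. Applying WDC to the positive reals and halving shows
  that {0} is a countable intersection of open intervals, so zero-sets of a P-space are clopen,
  whence strong zero-dimensionality.
*)
theory Submission
  imports Defs "HOL-Library.Countable_Set"
begin

section \<open>Renaming\<close>

text \<open>The choice operator of HOL is harmless because it acts only outside the models: inside,
  a subset or a function exists only if separation yields it. Hence every construction there comes
  with a formula, and no value is ever selected point by point. WDC supplies finite sets instead of
  a sequence. This is enough because all members of all these sets are used at once: a successor has
  to exist somewhere in the union, but none has to be singled out. The passage to models has to stay
  within one HOL type. The Henkin model consists of the variables, so equality is at first only a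
  congruence on the natural numbers. Making it true equality requires numbering the classes by all
  natural numbers again, which works because foundation excludes a model with finitely many classes.
  For zero-sets, the finite sets of positive reals come without any rate at which they approach
  zero. Convergence is therefore replaced by an order argument: a set of positive reals closed under
  halving has no positive strict lower bound, by completeness.\<close>

lemma ren_ren: "ren r (ren s p) = ren (\<lambda>i. r (s i)) p"
proof (induction p arbitrary: r s)
  case (All p)
  have "(\<lambda>i. case_nat 0 (\<lambda>i. Suc (r i)) (case_nat 0 (\<lambda>i. Suc (s i)) i)) = case_nat 0 (\<lambda>i. Suc (r (s i)))"
    by (auto split: nat.split)
  then show ?case by (simp add: All)
qed auto

lemma closed_fm_mono: "closed_fm m p \<Longrightarrow> m \<le> n \<Longrightarrow> closed_fm n p"
proof (induction p arbitrary: m n)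
  case (All p)
  then show ?case by (metis Suc_le_mono closed_fm.simps(5))
qed auto

lemma closed_fm_exists: "\<exists>n. closed_fm n p"
proof (induction p)
  case (Eq i j)
  show ?case by (rule exI[of _ "Suc (max i j)"]) auto
next
  case (Mem i j)
  show ?case by (rule exI[of _ "Suc (max i j)"]) auto
next
  case (Imp p q)
  then obtain m n where "closed_fm m p" "closed_fm n q" by blast
  then have "closed_fm (max m n) (Imp p q)"
    by (auto intro: closed_fm_mono)
  then show ?case by blast
next
  case (All p)
  then obtain m where "closed_fm m p" by blast
  then have "closed_fm m (All p)" by (auto intro: closed_fm_mono)
  then show ?case by blast
qed auto

lemma ren_cong: "closed_fm n p \<Longrightarrow> (\<And>i. i < n \<Longrightarrow> r i = s i) \<Longrightarrow> ren r p = ren s p"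
proof (induction p arbitrary: n r s)
  case (All p)
  show ?case using All.prems
    by (auto intro!: All.IH[of "Suc n"] split: nat.split)
next
  case (Imp p q)
  then show ?case by (metis closed_fm.simps(4) ren.simps(4))
qed auto

lemma ren_ident: "ren (\<lambda>i. i) p = p"
proof (induction p)
  case (All p)
  have "case_nat 0 (\<lambda>i. Suc i) = (\<lambda>i. i)"
    by (auto split: nat.split)
  then show ?case by (simp add: All)
qed auto

lemma ren_inst: "ren r (inst t p) = inst (r t) (ren (case_nat 0 (\<lambda>i. Suc (r i))) p)"
proof -
  have "(\<lambda>i. r (case_nat t (\<lambda>i. i) i)) = (\<lambda>i. case_nat (r t) (\<lambda>i. i) (case_nat 0 (\<lambda>i. Suc (r i)) i))"
    by (auto split: nat.split)
  then show ?thesis by (simp add: inst_def ren_ren)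
qed

text \<open>Syntactic counterpart of extending an assignment: on the right, \<open>c\<close> is
  pushed in front of \<open>r\<close> just as \<open>sat\<close> pushes a value in front of its
  assignment. This is what the quantifier case of the truth lemma consumes.\<close>

lemma inst_ren_lift: "inst c (ren (case_nat 0 (\<lambda>i. Suc (r i))) p) = ren (case_nat c r) p"
proof -
  have "(\<lambda>i. case_nat c (\<lambda>i. i) (case_nat 0 (\<lambda>i. Suc (r i)) i)) = case_nat c r"
    by (auto split: nat.split)
  then show ?thesis by (simp add: inst_def ren_ren)
qed

lemma ren_shift: "ren (case_nat 0 (\<lambda>i. Suc (r i))) (shift p) = shift (ren r p)"
  by (simp add: shift_def ren_ren)

section \<open>Derivations\<close>

lemma derives_weaken: "\<Gamma> \<turnstile> p \<Longrightarrow> \<Gamma> \<subseteq> \<Delta> \<Longrightarrow> \<Delta> \<turnstile> p"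
proof (induction arbitrary: \<Delta> rule: derives.induct)
  case (ImpI p \<Gamma> q)
  then show ?case by (meson derives.ImpI insert_mono)
next
  case (Class p \<Gamma>)
  then show ?case by (meson derives.Class insert_mono)
next
  case (AllI \<Gamma> p)
  then show ?case by (meson derives.AllI image_mono)
next
  case (EqSubst \<Gamma> s t p)
  then show ?case by (meson derives.EqSubst)
qed (auto intro: derives.intros)

text \<open>The renaming need not be injective: the rule \<open>AllI\<close> carries its
  eigenvariable in the shifted context, so lifting \<open>r\<close> under the quantifier keeps index
  0 apart from the hypotheses. The lemma makes a fresh variable as good as an eigenvariable.\<close>

lemma derives_ren: "\<Gamma> \<turnstile> p \<Longrightarrow> ren r ` \<Gamma> \<turnstile> ren r p"
proof (induction arbitrary: r rule: derives.induct)
  case (AllI \<Gamma> p)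
  have "ren (case_nat 0 (\<lambda>i. Suc (r i))) ` shift ` \<Gamma> \<turnstile> ren (case_nat 0 (\<lambda>i. Suc (r i))) p"
    by (rule AllI.IH)
  then show ?case
    by (auto simp: image_image ren_shift intro!: derives.AllI)
next
  case (AllE \<Gamma> p t)
  then show ?case by (simp add: ren_inst derives.AllE)
next
  case (EqSubst \<Gamma> s t p)
  then show ?case unfolding ren_inst by (metis derives.EqSubst ren.simps(2))
qed (auto intro: derives.intros)

text \<open>Needed for the limit of the Henkin chain: a contradiction from the union uses finitely
  many hypotheses, which already lie in one member.\<close>

lemma derives_compact: "\<Gamma> \<turnstile> p \<Longrightarrow> \<exists>\<Delta>. finite \<Delta> \<and> \<Delta> \<subseteq> \<Gamma> \<and> (\<Delta> \<turnstile> p)"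
proof (induction rule: derives.induct)
  case (Assm p \<Gamma>)
  then show ?case by (intro exI[of _ "{p}"]) (simp add: derives.Assm)
next
  case (ImpI p \<Gamma> q)
  then obtain \<Delta> where "finite \<Delta>" "\<Delta> \<subseteq> insert p \<Gamma>" "\<Delta> \<turnstile> q" by blast
  moreover from this have "\<Delta> - {p} \<turnstile> Imp p q"
    by - (rule derives.ImpI, rule derives_weaken[of \<Delta>], auto)
  ultimately show ?case by (intro exI[of _ "\<Delta> - {p}"]) auto
next
  case (ImpE \<Gamma> p q)
  then obtain \<Delta> \<Delta>' where "finite \<Delta>" "\<Delta> \<subseteq> \<Gamma>" "\<Delta> \<turnstile> Imp p q" "finite \<Delta>'" "\<Delta>' \<subseteq> \<Gamma>" "\<Delta>' \<turnstile> p"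
    by blast
  moreover from this have "\<Delta> \<union> \<Delta>' \<turnstile> q"
    by (meson derives.ImpE derives_weaken Un_upper1 Un_upper2)
  ultimately show ?case by (intro exI[of _ "\<Delta> \<union> \<Delta>'"]) simp
next
  case (Class p \<Gamma>)
  then obtain \<Delta> where "finite \<Delta>" "\<Delta> \<subseteq> insert (Imp p Fls) \<Gamma>" "\<Delta> \<turnstile> Fls" by blast
  moreover from this have "\<Delta> - {Imp p Fls} \<turnstile> p"
    by - (rule derives.Class, rule derives_weaken[of \<Delta>], auto)
  ultimately show ?case by (intro exI[of _ "\<Delta> - {Imp p Fls}"]) auto
next
  case (AllI \<Gamma> p)
  then obtain \<Delta> where \<Delta>: "finite \<Delta>" "\<Delta> \<subseteq> shift ` \<Gamma>" "\<Delta> \<turnstile> p" by blast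
  then obtain \<Delta>' where "\<Delta>' \<subseteq> \<Gamma>" "finite \<Delta>'" "\<Delta> = shift ` \<Delta>'"
    by (metis finite_subset_image)
  with \<Delta> show ?case by (metis derives.AllI)
next
  case (AllE \<Gamma> p t)
  then show ?case by (meson derives.AllE)
next
  case (EqRefl \<Gamma> t)
  show ?case by (intro exI[of _ "{}"]) (simp add: derives.EqRefl)
next
  case (EqSubst \<Gamma> s t p)
  then obtain \<Delta> \<Delta>' where "finite \<Delta>" "\<Delta> \<subseteq> \<Gamma>" "\<Delta> \<turnstile> Eq s t" "finite \<Delta>'" "\<Delta>' \<subseteq> \<Gamma>" "\<Delta>' \<turnstile> inst s p"
    by blast
  moreover from this have "\<Delta> \<union> \<Delta>' \<turnstile> inst t p"
    by (meson derives.EqSubst derives_weaken Un_upper1 Un_upper2)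
  ultimately show ?case by (intro exI[of _ "\<Delta> \<union> \<Delta>'"]) simp
qed

text \<open>Generalization over a named fresh variable: \<open>c\<close> lies above all free indices
  of \<open>\<Gamma>\<close> and does not occur freely in \<open>All q\<close>, so it can be renamed
  to the eigenvariable 0.\<close>

lemma derives_AllI_fresh:
  assumes "\<Gamma> \<turnstile> inst c q" "\<And>p. p \<in> \<Gamma> \<Longrightarrow> closed_fm c p" "closed_fm (Suc c) q"
  shows "\<Gamma> \<turnstile> All q"
proof -
  \<comment> \<open>On indices below \<open>c\<close> this is the shift, which is all that the
    hypotheses see; sending \<open>c\<close> to 0 undoes the instantiation in
    \<open>inst c q\<close>.\<close>
  define r where "r i = (if i = c then 0 else Suc i)" for i
  have "ren r ` \<Gamma> = shift ` \<Gamma>"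
    unfolding shift_def by (intro image_cong refl ren_cong[OF assms(2)]) (auto simp: r_def)
  moreover have "ren r (inst c q) = q"
  proof -
    have "ren r (inst c q) = ren (\<lambda>i. i) q"
      unfolding inst_def ren_ren
      by (intro ren_cong[OF assms(3)]) (auto simp: r_def split: nat.split)
    then show ?thesis by (simp add: ren_ident)
  qed
  ultimately show ?thesis
    using derives_ren[OF assms(1), of r] by (auto intro: derives.AllI)
qed

section \<open>Completeness\<close>

instance fm :: countable
  by countable_datatype

section \<open>Extension to a complete consistent set with witnesses\<close>

definition consistent :: "fm set \<Rightarrow> bool" where
  "consistent \<Gamma> \<longleftrightarrow> \<not> (\<Gamma> \<turnstile> Fls)"

text \<open>Guarantees that fresh variables remain. Variables themselves serve as Henkin constants,
  so the language is not extended.\<close>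

definition bounded :: "fm set \<Rightarrow> bool" where
  "bounded \<Gamma> \<longleftrightarrow> (\<exists>c. \<forall>p\<in>\<Gamma>. closed_fm c p)"

lemma bounded_insert: "bounded \<Gamma> \<Longrightarrow> bounded (insert p \<Gamma>)"
proof -
  assume "bounded \<Gamma>"
  then obtain c where c: "\<forall>p\<in>\<Gamma>. closed_fm c p" by (auto simp: bounded_def)
  obtain d where d: "closed_fm d p" using closed_fm_exists by blast
  have "\<forall>q\<in>insert p \<Gamma>. closed_fm (max c d) q"
    using c d by (auto intro: closed_fm_mono)
  then show ?thesis by (auto simp: bounded_def)
qed

text \<open>One stage decides \<open>p\<close>. If \<open>p\<close> cannot be added, its negation is
  derivable and is added; for a refuted universal formula a counterexample at a fresh variable is
  added as well, since refuting that instance would derive the universal formula.\<close>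

lemma Henkin_step:
  assumes "consistent \<Gamma>" "bounded \<Gamma>"
  obtains \<Delta> where "\<Gamma> \<subseteq> \<Delta>" "consistent \<Delta>" "bounded \<Delta>" "p \<in> \<Delta> \<or> Imp p Fls \<in> \<Delta>"
    "\<And>q. p = All q \<Longrightarrow> p \<in> \<Delta> \<or> (\<exists>c. Imp (inst c q) Fls \<in> \<Delta>)"
proof (cases "consistent (insert p \<Gamma>)")
  case True
  with assms show ?thesis by (intro that[of "insert p \<Gamma>"]) (auto intro: bounded_insert)
next
  case False
  let ?\<Gamma> = "insert (Imp p Fls) \<Gamma>"
  have "\<Gamma> \<turnstile> Imp p Fls" using False by (auto simp: consistent_def intro: derives.intros)
  then have con: "consistent ?\<Gamma>"
    using assms(1) by (auto simp: consistent_def intro: derives.ImpI derives.ImpE)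
  have bd: "bounded ?\<Gamma>" by (rule bounded_insert[OF assms(2)])
  show ?thesis
  proof (cases "\<exists>q. p = All q")
    case True
    then obtain q where q: "p = All q" by blast
    \<comment> \<open>Inserting \<open>q\<close> before taking the bound makes the same
      \<open>c\<close> fresh for the hypotheses and for \<open>q\<close>.\<close>
    from bounded_insert[OF bd, of q] obtain c
      where c: "closed_fm c q" "\<And>p. p \<in> ?\<Gamma> \<Longrightarrow> closed_fm c p"
      unfolding bounded_def by blast
    have "consistent (insert (Imp (inst c q) Fls) ?\<Gamma>)"
    proof (rule ccontr)
      assume "\<not> ?thesis"
      then have "?\<Gamma> \<turnstile> inst c q" by (auto simp: consistent_def intro: derives.Class)
      then have "?\<Gamma> \<turnstile> All q"
        using c by (intro derives_AllI_fresh) (auto intro: closed_fm_mono)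
      moreover have "?\<Gamma> \<turnstile> Imp (All q) Fls" using q by (auto intro: derives.Assm)
      ultimately show False using con by (auto simp: consistent_def intro: derives.ImpE)
    qed
    with q bd show ?thesis
      by (intro that[of "insert (Imp (inst c q) Fls) ?\<Gamma>"]) (auto intro: bounded_insert)
  next
    case False
    with con bd show ?thesis by (intro that[of ?\<Gamma>]) auto
  qed
qed

text \<open>Formulas are countable, so stage n can treat the formula with code n. Each stage is
  bounded and leaves room for the next witness; only consistency has to pass to the union, and
  compactness takes care of it.\<close>

lemma Henkin_extension:
  assumes "consistent \<Gamma>" "bounded \<Gamma>"
  obtains H where "\<Gamma> \<subseteq> H" "consistent H" "\<And>p. p \<in> H \<or> Imp p Fls \<in> H"
    "\<And>q. All q \<in> H \<or> (\<exists>c. Imp (inst c q) Fls \<in> H)"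
proof -
  define P where "P \<Delta> \<longleftrightarrow> consistent \<Delta> \<and> bounded \<Delta> \<and> \<Gamma> \<subseteq> \<Delta>" for \<Delta>
  define Q where "Q p \<Delta> \<Delta>' \<longleftrightarrow> \<Delta> \<subseteq> \<Delta>' \<and> (p \<in> \<Delta>' \<or> Imp p Fls \<in> \<Delta>') \<and>
    (\<forall>q. p = All q \<longrightarrow> All q \<in> \<Delta>' \<or> (\<exists>c. Imp (inst c q) Fls \<in> \<Delta>'))" for p \<Delta> \<Delta>'
  have step: "\<exists>\<Delta>'. P \<Delta>' \<and> Q p \<Delta> \<Delta>'" if "P \<Delta>" for p \<Delta>
  proof -
    from that have \<Delta>: "consistent \<Delta>" "bounded \<Delta>" "\<Gamma> \<subseteq> \<Delta>" by (auto simp: P_def)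
    obtain \<Delta>' where "\<Delta> \<subseteq> \<Delta>'" "consistent \<Delta>'" "bounded \<Delta>'" "p \<in> \<Delta>' \<or> Imp p Fls \<in> \<Delta>'"
      "\<And>q. p = All q \<Longrightarrow> p \<in> \<Delta>' \<or> (\<exists>c. Imp (inst c q) Fls \<in> \<Delta>')"
      by (rule Henkin_step[OF \<Delta>(1,2), of p]) blast
    with \<Delta>(3) show ?thesis
      unfolding P_def Q_def by (intro exI[of _ \<Delta>']) auto
  qed
  obtain f where P: "\<And>n. P (f n)" and Q: "\<And>n. Q (from_nat n) (f n) (f (Suc n))"
  proof -
    have "\<exists>\<Delta>. P \<Delta>" using assms by (auto simp: P_def)
    then show ?thesis
      using dependent_nat_choice[of "\<lambda>_. P" "\<lambda>n. Q (from_nat n)"] step that by blast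
  qed
  have f: "consistent (f n)" "\<Gamma> \<subseteq> f n" "f n \<subseteq> f (Suc n)" for n
    using P[of n] Q[of n] by (auto simp: P_def Q_def)
  have dec: "from_nat n \<in> f (Suc n) \<or> Imp (from_nat n) Fls \<in> f (Suc n)" for n
    using Q[of n] by (auto simp: Q_def)
  have wit: "All q \<in> f (Suc n) \<or> (\<exists>c. Imp (inst c q) Fls \<in> f (Suc n))" if "from_nat n = All q" for n q
    using Q[of n] that by (auto simp: Q_def)
  have mono: "mono f" using f(3) by (simp add: mono_iff_le_Suc)
  have "consistent (\<Union>n. f n)"
  proof (rule ccontr)
    assume "\<not> ?thesis"
    then obtain \<Delta> where \<Delta>: "finite \<Delta>" "\<Delta> \<subseteq> (\<Union>n. f n)" "\<Delta> \<turnstile> Fls"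
      using derives_compact[of "\<Union>n. f n" Fls] by (auto simp: consistent_def)
    have "\<exists>n. \<Delta> \<subseteq> f n" using \<Delta>(1,2)
    proof (induction \<Delta>)
      case (insert p \<Delta>)
      then obtain n m where "\<Delta> \<subseteq> f n" "p \<in> f m" by auto
      then have "insert p \<Delta> \<subseteq> f (max n m)"
        using monoD[OF mono, of n "max n m"] monoD[OF mono, of m "max n m"] by auto
      then show ?case by blast
    qed auto
    with \<Delta>(3) f(1) show False by (auto simp: consistent_def intro: derives_weaken)
  qed
  moreover have "\<Gamma> \<subseteq> (\<Union>n. f n)" using f(2) by blast
  moreover have "p \<in> (\<Union>n. f n) \<or> Imp p Fls \<in> (\<Union>n. f n)" for p
    using dec[of "to_nat p"] by auto
  moreover have "All q \<in> (\<Union>n. f n) \<or> (\<exists>c. Imp (inst c q) Fls \<in> (\<Union>n. f n))" for q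
    using wit[of "to_nat (All q)" q] by auto
  ultimately show ?thesis using that by blast
qed

text \<open>Equality is a parameter because the term model interprets it by provable equality of
  variables, which is not identity; the quotient is taken later.\<close>

primrec sat :: "('a \<Rightarrow> 'a \<Rightarrow> bool) \<Rightarrow> ('a \<Rightarrow> 'a \<Rightarrow> bool) \<Rightarrow> (nat \<Rightarrow> 'a) \<Rightarrow> fm \<Rightarrow> bool" where
  "sat eq mem e Fls \<longleftrightarrow> False"
| "sat eq mem e (Eq i j) \<longleftrightarrow> eq (e i) (e j)"
| "sat eq mem e (Mem i j) \<longleftrightarrow> mem (e i) (e j)"
| "sat eq mem e (Imp p q) \<longleftrightarrow> (sat eq mem e p \<longrightarrow> sat eq mem e q)"
| "sat eq mem e (All p) \<longleftrightarrow> (\<forall>d. sat eq mem (case_nat d e) p)"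

definition congruence :: "('a \<Rightarrow> 'a \<Rightarrow> bool) \<Rightarrow> ('a \<Rightarrow> 'a \<Rightarrow> bool) \<Rightarrow> bool" where
  "congruence eq mem \<longleftrightarrow> equivp eq \<and> (\<forall>x x' y y'. eq x x' \<and> eq y y' \<and> mem x y \<longrightarrow> mem x' y')"

text \<open>The countermodel lives on the variables, with atomic truth read off from a Henkin set
  containing \<open>Imp p Fls\<close>. This is why validity over the single type \<open>nat\<close>
  suffices.\<close>

lemma completeness:
  assumes closed: "\<And>q. q \<in> \<Gamma> \<Longrightarrow> closed_fm 0 q"
    and valid: "\<And>eq mem (e::nat \<Rightarrow> nat). congruence eq mem \<Longrightarrow>
      (\<And>q e. q \<in> \<Gamma> \<Longrightarrow> sat eq mem e q) \<Longrightarrow> sat eq mem e p"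
  shows "\<Gamma> \<turnstile> p"
proof (rule ccontr)
  assume np: "\<not> (\<Gamma> \<turnstile> p)"
  have "consistent (insert (Imp p Fls) \<Gamma>)"
    using np by (auto simp: consistent_def intro: derives.Class)
  then obtain H where sub: "insert (Imp p Fls) \<Gamma> \<subseteq> H" and con: "consistent H"
    and dec: "\<And>p. p \<in> H \<or> Imp p Fls \<in> H"
    and wit: "\<And>q. All q \<in> H \<or> (\<exists>c. Imp (inst c q) Fls \<in> H)"
    using Henkin_extension bounded_insert closed unfolding bounded_def by metis
  have not_both: "\<not> (q \<in> H \<and> Imp q Fls \<in> H)" for q
    using con by (auto simp: consistent_def intro: derives.Assm derives.ImpE)
  have ded: "q \<in> H" if "H \<turnstile> q" for q
    using dec[of q] con that by (auto simp: consistent_def intro: derives.Assm derives.ImpE)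
  have Fls: "Fls \<notin> H" using con by (auto simp: consistent_def intro: derives.Assm)
  have Imp: "Imp q r \<in> H \<longleftrightarrow> (q \<in> H \<longrightarrow> r \<in> H)" for q r
  proof
    show "q \<in> H \<longrightarrow> r \<in> H" if "Imp q r \<in> H"
      using that by (auto intro: ded derives.Assm derives.ImpE)
  next
    assume *: "q \<in> H \<longrightarrow> r \<in> H"
    show "Imp q r \<in> H"
    proof (cases "q \<in> H")
      case True
      with * show ?thesis by (auto intro!: ded derives.ImpI intro: derives.Assm)
    next
      case False
      then have "Imp q Fls \<in> H" using dec by blast
      then have "insert q H \<turnstile> Fls" by (auto intro: derives.Assm derives.ImpE)
      then show ?thesis
        by (auto intro!: ded derives.ImpI derives.Class[of r] elim: derives_weaken)
    qed
  qed
  have All: "All q \<in> H \<longleftrightarrow> (\<forall>c. inst c q \<in> H)" for q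
    using wit[of q] not_both by (auto intro: ded derives.Assm derives.AllE)
  define eq where "eq i j \<longleftrightarrow> Eq i j \<in> H" for i j
  define mem where "mem i j \<longleftrightarrow> Mem i j \<in> H" for i j
  have subst: "inst t q \<in> H" if "eq s t" "inst s q \<in> H" for s t q
    using that by (auto simp: eq_def intro: ded derives.Assm derives.EqSubst)
  have "eq s s" for s by (auto simp: eq_def intro: ded derives.EqRefl)
  \<comment> \<open>Index 0 marks the place of replacement in each instance of \<open>subst\<close>;
    \<open>Suc\<close> protects the other variable, which instantiation lowers again.\<close>
  moreover have sym: "eq t s" if "eq s t" for s t
    using that calculation[of s] subst[of s t "Eq 0 (Suc s)"] by (auto simp: inst_def eq_def)
  moreover have "eq s u" if "eq s t" "eq t u" for s t u
    using that subst[of t u "Eq (Suc s) 0"] by (auto simp: inst_def eq_def)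
  ultimately have "equivp eq" by (metis equivpI reflpI sympI transpI)
  moreover have "mem s' t'" if "eq s s'" "eq t t'" "mem s t" for s s' t t'
    using that subst[of s s' "Mem 0 (Suc t)"] subst[of t t' "Mem (Suc s') 0"]
    by (auto simp: inst_def mem_def)
  ultimately have "congruence eq mem" by (auto simp: congruence_def)
  \<comment> \<open>Values are variables, so an assignment is itself a renaming. The claim has to
    cover all assignments for the induction to pass a quantifier; the identity assignment then
    refutes \<open>p\<close>.\<close>
  moreover have truth: "sat eq mem e q \<longleftrightarrow> ren e q \<in> H" for e q
  proof (induction q arbitrary: e)
    case (All q)
    then show ?case by (simp add: \<open>\<And>q. All q \<in> H \<longleftrightarrow> _ q\<close> inst_ren_lift)
  qed (auto simp: Fls Imp eq_def mem_def)
  moreover have "ren e q = q" if "q \<in> \<Gamma>" for e q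
    using ren_cong[OF closed[OF that], of e "\<lambda>i. i"] by (simp add: ren_ident)
  ultimately have "sat eq mem (\<lambda>i. i) p"
    using sub by (intro valid) auto
  then show False using truth sub not_both by (auto simp: ren_ident)
qed

section \<open>Semantics of the notation with named variables\<close>

text \<open>The list \<open>l\<close> holds the values of the variables (levels) and \<open>e\<close> those of the parameters.\<close>

definition holds :: "('a \<Rightarrow> 'a \<Rightarrow> bool) \<Rightarrow> (nat \<Rightarrow> 'a) \<Rightarrow> 'a list \<Rightarrow> form \<Rightarrow> bool" where
  "holds mem e l P \<longleftrightarrow>
    sat (=) mem (\<lambda>i. if i < length l then l ! (length l - Suc i) else e (i - length l)) (P (length l))"

lemma holds_Mem [simp]:
  "x < length l \<Longrightarrow> y < length l \<Longrightarrow> holds mem e l (x \<^bold>\<in> y) \<longleftrightarrow> mem (l ! x) (l ! y)"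
  by (auto simp add: holds_def fMem_def)

lemma holds_Eq [simp]:
  "x < length l \<Longrightarrow> y < length l \<Longrightarrow> holds mem e l (x \<^bold>= y) \<longleftrightarrow> l ! x = l ! y"
  by (auto simp add: holds_def fEq_def)

lemma holds_Imp [simp]: "holds mem e l (P \<^bold>\<longrightarrow> Q) \<longleftrightarrow> (holds mem e l P \<longrightarrow> holds mem e l Q)"
  by (simp add: holds_def fImp_def)

lemma holds_Not [simp]: "holds mem e l (\<^bold>\<not> P) \<longleftrightarrow> \<not> holds mem e l P"
  by (simp add: holds_def fNot_def)

lemma holds_And [simp]: "holds mem e l (P \<^bold>\<and> Q) \<longleftrightarrow> holds mem e l P \<and> holds mem e l Q"
  by (simp add: fAnd_def)

lemma holds_Or [simp]: "holds mem e l (P \<^bold>\<or> Q) \<longleftrightarrow> holds mem e l P \<or> holds mem e l Q"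
  by (auto simp add: fOr_def)

lemma holds_Iff [simp]: "holds mem e l (P \<^bold>\<longleftrightarrow> Q) \<longleftrightarrow> (holds mem e l P \<longleftrightarrow> holds mem e l Q)"
  by (auto simp add: fIff_def)

lemma holds_All [simp]: "holds mem e l (fAll P) \<longleftrightarrow> (\<forall>d. holds mem e (l @ [d]) (P (length l)))"
proof -
  \<comment> \<open>A new quantifier pushes its value to index 0 but appends it at the end of the
    level list, so variables that are already named keep their positions.\<close>
  have "case_nat d (\<lambda>i. if i < length l then l ! (length l - Suc i) else e (i - length l)) =
    (\<lambda>i. if i < length (l @ [d]) then (l @ [d]) ! (length (l @ [d]) - Suc i)
      else e (i - length (l @ [d])))" for d
    by (auto simp: fun_eq_iff nth_append split: nat.split)
  then show ?thesis by (simp add: holds_def fAll_def)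
qed

lemma holds_Ex [simp]: "holds mem e l (fEx P) \<longleftrightarrow> (\<exists>d. holds mem e (l @ [d]) (P (length l)))"
  by (simp add: fEx_def)

lemma sat_ren: "sat eq mem e (ren r p) \<longleftrightarrow> sat eq mem (\<lambda>i. e (r i)) p"
proof (induction p arbitrary: e r)
  case (All p)
  have "(\<lambda>i. case_nat d e (case_nat 0 (\<lambda>i. Suc (r i)) i)) = case_nat d (\<lambda>i. e (r i))" for d
    by (auto split: nat.split)
  then show ?case by (simp add: All)
qed auto

lemma holds_app1 [simp]:
  "x < length l \<Longrightarrow> holds mem e l (app1 p x) \<longleftrightarrow> sat (=) mem (case_nat (l ! x) e) p"
  unfolding holds_def app1_def sat_ren
  by (intro arg_cong2[of _ _ _ _ "sat (=) mem"]) (auto simp: fun_eq_iff split: nat.split)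

text \<open>Bound variables acquire the levels \<open>length l\<close>,
  \<open>Suc (length l)\<close> and so on. Ten rules match the deepest nesting within one
  definition: in \<open>WDC\<close> the last \<open>y\<close> stands below \<open>E\<close>,
  \<open>R\<close>, \<open>w\<close>, \<open>F\<close>, \<open>n\<close>, \<open>m\<close>,
  \<open>A\<close>, \<open>B\<close> and \<open>x\<close>.\<close>

lemma nth_append_Suc_length [simp]:
  "(l @ xs) ! (length l) = xs ! 0"
  "(l @ xs) ! (Suc (length l)) = xs ! 1"
  "(l @ xs) ! (Suc (Suc (length l))) = xs ! 2"
  "(l @ xs) ! (Suc (Suc (Suc (length l)))) = xs ! 3"
  "(l @ xs) ! (Suc (Suc (Suc (Suc (length l))))) = xs ! 4"
  "(l @ xs) ! (Suc (Suc (Suc (Suc (Suc (length l)))))) = xs ! 5"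
  "(l @ xs) ! (Suc (Suc (Suc (Suc (Suc (Suc (length l))))))) = xs ! 6"
  "(l @ xs) ! (Suc (Suc (Suc (Suc (Suc (Suc (Suc (length l)))))))) = xs ! 7"
  "(l @ xs) ! (Suc (Suc (Suc (Suc (Suc (Suc (Suc (Suc (length l))))))))) = xs ! 8"
  "(l @ xs) ! (Suc (Suc (Suc (Suc (Suc (Suc (Suc (Suc (Suc (length l)))))))))) = xs ! 9"
  by (simp_all add: nth_append eval_nat_numeral)

lemma nth_append_less [simp]: "i < length l \<Longrightarrow> (l @ xs) ! i = l ! i"
  by (simp add: nth_append)

text \<open>
  Inside the locale, \<open>m_foo\<close> is the relation on \<open>'a\<close> that the formula \<open>foo\<close> defines when set
  membership is read as \<open>mem\<close>.
\<close>

locale membership =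
  fixes mem :: "'a \<Rightarrow> 'a \<Rightarrow> bool" (infix \<open>\<epsilon>\<close> 50)
begin

definition m_subset :: "'a \<Rightarrow> 'a \<Rightarrow> bool" where
  "m_subset a b \<longleftrightarrow>
    (\<forall>x. x \<epsilon> a \<longrightarrow> x \<epsilon> b)"

lemma holds_subset [simp]:
  "a < length l \<Longrightarrow> b < length l \<Longrightarrow>
    holds (\<epsilon>) v l (subset a b) \<longleftrightarrow> m_subset (l ! a) (l ! b)"
  by (simp add: subset_def m_subset_def)

definition m_nonempty :: "'a \<Rightarrow> bool" where
  "m_nonempty a \<longleftrightarrow>
    (\<exists>x. x \<epsilon> a)"

lemma holds_nonempty [simp]:
  "a < length l \<Longrightarrow>
    holds (\<epsilon>) v l (nonempty a) \<longleftrightarrow> m_nonempty (l ! a)"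
  by (simp add: nonempty_def m_nonempty_def)

definition m_disjoint :: "'a \<Rightarrow> 'a \<Rightarrow> bool" where
  "m_disjoint a b \<longleftrightarrow>
    (\<not> (\<exists>x. x \<epsilon> a \<and> x \<epsilon> b))"

lemma holds_disjoint [simp]:
  "a < length l \<Longrightarrow> b < length l \<Longrightarrow>
    holds (\<epsilon>) v l (disjoint a b) \<longleftrightarrow> m_disjoint (l ! a) (l ! b)"
  by (simp add: disjoint_def m_disjoint_def)

definition m_is_upair :: "'a \<Rightarrow> 'a \<Rightarrow> 'a \<Rightarrow> bool" where
  "m_is_upair c a b \<longleftrightarrow>
    (\<forall>x. x \<epsilon> c \<longleftrightarrow> x = a \<or> x = b)"

lemma holds_is_upair [simp]:
  "c < length l \<Longrightarrow> a < length l \<Longrightarrow> b < length l \<Longrightarrow>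
    holds (\<epsilon>) v l (is_upair c a b) \<longleftrightarrow> m_is_upair (l ! c) (l ! a) (l ! b)"
  by (simp add: is_upair_def m_is_upair_def)

definition m_is_pair :: "'a \<Rightarrow> 'a \<Rightarrow> 'a \<Rightarrow> bool" where
  "m_is_pair p a b \<longleftrightarrow>
    (\<exists>s t. m_is_upair s a a \<and> m_is_upair t a b \<and> m_is_upair p s t)"

lemma holds_is_pair [simp]:
  "p < length l \<Longrightarrow> a < length l \<Longrightarrow> b < length l \<Longrightarrow>
    holds (\<epsilon>) v l (is_pair p a b) \<longleftrightarrow> m_is_pair (l ! p) (l ! a) (l ! b)"
  by (simp add: is_pair_def m_is_pair_def)

definition m_is_Union :: "'a \<Rightarrow> 'a \<Rightarrow> bool" where
  "m_is_Union u A \<longleftrightarrow>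
    (\<forall>x. x \<epsilon> u \<longleftrightarrow> (\<exists>a. a \<epsilon> A \<and> x \<epsilon> a))"

lemma holds_is_Union [simp]:
  "u < length l \<Longrightarrow> A < length l \<Longrightarrow>
    holds (\<epsilon>) v l (is_Union u A) \<longleftrightarrow> m_is_Union (l ! u) (l ! A)"
  by (simp add: is_Union_def m_is_Union_def)

definition m_is_inter :: "'a \<Rightarrow> 'a \<Rightarrow> 'a \<Rightarrow> bool" where
  "m_is_inter c a b \<longleftrightarrow>
    (\<forall>x. x \<epsilon> c \<longleftrightarrow> x \<epsilon> a \<and> x \<epsilon> b)"

lemma holds_is_inter [simp]:
  "c < length l \<Longrightarrow> a < length l \<Longrightarrow> b < length l \<Longrightarrow>
    holds (\<epsilon>) v l (is_inter c a b) \<longleftrightarrow> m_is_inter (l ! c) (l ! a) (l ! b)"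
  by (simp add: is_inter_def m_is_inter_def)

definition m_is_diff :: "'a \<Rightarrow> 'a \<Rightarrow> 'a \<Rightarrow> bool" where
  "m_is_diff c a b \<longleftrightarrow>
    (\<forall>x. x \<epsilon> c \<longleftrightarrow> x \<epsilon> a \<and> \<not> x \<epsilon> b)"

lemma holds_is_diff [simp]:
  "c < length l \<Longrightarrow> a < length l \<Longrightarrow> b < length l \<Longrightarrow>
    holds (\<epsilon>) v l (is_diff c a b) \<longleftrightarrow> m_is_diff (l ! c) (l ! a) (l ! b)"
  by (simp add: is_diff_def m_is_diff_def)

definition m_is_succ :: "'a \<Rightarrow> 'a \<Rightarrow> bool" where
  "m_is_succ s n \<longleftrightarrow>
    (\<forall>x. x \<epsilon> s \<longleftrightarrow> x \<epsilon> n \<or> x = n)"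

lemma holds_is_succ [simp]:
  "s < length l \<Longrightarrow> n < length l \<Longrightarrow>
    holds (\<epsilon>) v l (is_succ s n) \<longleftrightarrow> m_is_succ (l ! s) (l ! n)"
  by (simp add: is_succ_def m_is_succ_def)

definition m_successor_closed :: "'a \<Rightarrow> bool" where
  "m_successor_closed I \<longleftrightarrow>
    ((\<exists>e. e \<epsilon> I \<and> \<not> m_nonempty e) \<and>
     (\<forall>n. n \<epsilon> I \<longrightarrow> (\<exists>s. s \<epsilon> I \<and> m_is_succ s n)))"

lemma holds_successor_closed [simp]:
  "I < length l \<Longrightarrow>
    holds (\<epsilon>) v l (successor_closed I) \<longleftrightarrow> m_successor_closed (l ! I)"
  by (simp add: successor_closed_def m_successor_closed_def)

definition m_is_omega :: "'a \<Rightarrow> bool" where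
  "m_is_omega w \<longleftrightarrow>
    (m_successor_closed w \<and> (\<forall>I. m_successor_closed I \<longrightarrow> m_subset w I))"

lemma holds_is_omega [simp]:
  "w < length l \<Longrightarrow>
    holds (\<epsilon>) v l (is_omega w) \<longleftrightarrow> m_is_omega (l ! w)"
  by (simp add: is_omega_def m_is_omega_def)

definition m_rel :: "'a \<Rightarrow> 'a \<Rightarrow> 'a \<Rightarrow> bool" where
  "m_rel r x y \<longleftrightarrow>
    (\<exists>p. m_is_pair p x y \<and> p \<epsilon> r)"

lemma holds_rel [simp]:
  "r < length l \<Longrightarrow> x < length l \<Longrightarrow> y < length l \<Longrightarrow>
    holds (\<epsilon>) v l (rel r x y) \<longleftrightarrow> m_rel (l ! r) (l ! x) (l ! y)"
  by (simp add: rel_def m_rel_def)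

definition m_relation_on :: "'a \<Rightarrow> 'a \<Rightarrow> bool" where
  "m_relation_on r E \<longleftrightarrow>
    (\<forall>p. p \<epsilon> r \<longrightarrow> (\<exists>x y. x \<epsilon> E \<and> y \<epsilon> E \<and> m_is_pair p x y))"

lemma holds_relation_on [simp]:
  "r < length l \<Longrightarrow> E < length l \<Longrightarrow>
    holds (\<epsilon>) v l (relation_on r E) \<longleftrightarrow> m_relation_on (l ! r) (l ! E)"
  by (simp add: relation_on_def m_relation_on_def)

definition m_function_on :: "'a \<Rightarrow> 'a \<Rightarrow> bool" where
  "m_function_on f A \<longleftrightarrow>
    ((\<forall>p. p \<epsilon> f \<longrightarrow> (\<exists>x y. x \<epsilon> A \<and> m_is_pair p x y)) \<and>
     (\<forall>x. x \<epsilon> A \<longrightarrow> (\<exists>y. m_rel f x y)) \<and>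
     (\<forall>x y z. m_rel f x y \<and> m_rel f x z \<longrightarrow> y = z))"

lemma holds_function_on [simp]:
  "f < length l \<Longrightarrow> A < length l \<Longrightarrow>
    holds (\<epsilon>) v l (function_on f A) \<longleftrightarrow> m_function_on (l ! f) (l ! A)"
  by (simp add: function_on_def m_function_on_def)

definition m_function_to :: "'a \<Rightarrow> 'a \<Rightarrow> 'a \<Rightarrow> bool" where
  "m_function_to f A B \<longleftrightarrow>
    (m_function_on f A \<and> (\<forall>x y. m_rel f x y \<longrightarrow> y \<epsilon> B))"

lemma holds_function_to [simp]:
  "f < length l \<Longrightarrow> A < length l \<Longrightarrow> B < length l \<Longrightarrow>
    holds (\<epsilon>) v l (function_to f A B) \<longleftrightarrow> m_function_to (l ! f) (l ! A) (l ! B)"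
  by (simp add: function_to_def m_function_to_def)

definition m_bijection :: "'a \<Rightarrow> 'a \<Rightarrow> 'a \<Rightarrow> bool" where
  "m_bijection f A B \<longleftrightarrow>
    (m_function_to f A B \<and>
     (\<forall>x y z. m_rel f x z \<and> m_rel f y z \<longrightarrow> x = y) \<and>
     (\<forall>y. y \<epsilon> B \<longrightarrow> (\<exists>x. m_rel f x y)))"

lemma holds_bijection [simp]:
  "f < length l \<Longrightarrow> A < length l \<Longrightarrow> B < length l \<Longrightarrow>
    holds (\<epsilon>) v l (bijection f A B) \<longleftrightarrow> m_bijection (l ! f) (l ! A) (l ! B)"
  by (simp add: bijection_def m_bijection_def)

definition m_finite_set :: "'a \<Rightarrow> bool" where
  "m_finite_set A \<longleftrightarrow>
    (\<exists>w n f. m_is_omega w \<and> n \<epsilon> w \<and> m_bijection f n A)"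

lemma holds_finite_set [simp]:
  "A < length l \<Longrightarrow>
    holds (\<epsilon>) v l (finite_set A) \<longleftrightarrow> m_finite_set (l ! A)"
  by (simp add: finite_set_def m_finite_set_def)

definition m_WDC :: bool where
  "m_WDC \<longleftrightarrow>
    (\<forall>E R.
    m_nonempty E \<and> m_relation_on R E \<and> (\<forall>x. x \<epsilon> E \<longrightarrow> (\<exists>y. y \<epsilon> E \<and> m_rel R x y)) \<longrightarrow>
    (\<exists>w F. m_is_omega w \<and> m_function_on F w \<and>
      (\<forall>n A. n \<epsilon> w \<and> m_rel F n A \<longrightarrow> m_nonempty A \<and> m_finite_set A \<and> m_subset A E) \<and>
      (\<forall>n m A B. n \<epsilon> w \<and> m_is_succ m n \<and> m_rel F n A \<and> m_rel F m B \<longrightarrow>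
        (\<forall>x. x \<epsilon> A \<longrightarrow> (\<exists>y. y \<epsilon> B \<and> m_rel R x y)))))"

lemma holds_WDC [simp]:
  "holds (\<epsilon>) v l WDC \<longleftrightarrow> m_WDC"
  by (simp add: WDC_def m_WDC_def)

definition m_topology :: "'a \<Rightarrow> 'a \<Rightarrow> bool" where
  "m_topology X T \<longleftrightarrow>
    ((\<forall>U. U \<epsilon> T \<longrightarrow> m_subset U X) \<and> X \<epsilon> T \<and>
     (\<forall>U V W. U \<epsilon> T \<and> V \<epsilon> T \<and> m_is_inter W U V \<longrightarrow> W \<epsilon> T) \<and>
     (\<forall>S U. m_subset S T \<and> m_is_Union U S \<longrightarrow> U \<epsilon> T))"

lemma holds_topology [simp]:
  "X < length l \<Longrightarrow> T < length l \<Longrightarrow>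
    holds (\<epsilon>) v l (topology X T) \<longleftrightarrow> m_topology (l ! X) (l ! T)"
  by (simp add: topology_def m_topology_def)

definition m_closed_in :: "'a \<Rightarrow> 'a \<Rightarrow> 'a \<Rightarrow> bool" where
  "m_closed_in X T C \<longleftrightarrow>
    (m_subset C X \<and> (\<exists>U. U \<epsilon> T \<and> m_is_diff U X C))"

lemma holds_closed_in [simp]:
  "X < length l \<Longrightarrow> T < length l \<Longrightarrow> C < length l \<Longrightarrow>
    holds (\<epsilon>) v l (closed_in X T C) \<longleftrightarrow> m_closed_in (l ! X) (l ! T) (l ! C)"
  by (simp add: closed_in_def m_closed_in_def)

definition m_clopen_in :: "'a \<Rightarrow> 'a \<Rightarrow> 'a \<Rightarrow> bool" where
  "m_clopen_in X T U \<longleftrightarrow>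
    (U \<epsilon> T \<and> m_closed_in X T U)"

lemma holds_clopen_in [simp]:
  "X < length l \<Longrightarrow> T < length l \<Longrightarrow> U < length l \<Longrightarrow>
    holds (\<epsilon>) v l (clopen_in X T U) \<longleftrightarrow> m_clopen_in (l ! X) (l ! T) (l ! U)"
  by (simp add: clopen_in_def m_clopen_in_def)

definition m_is_closure :: "'a \<Rightarrow> 'a \<Rightarrow> 'a \<Rightarrow> 'a \<Rightarrow> bool" where
  "m_is_closure X T C A \<longleftrightarrow>
    (\<forall>x. x \<epsilon> C \<longleftrightarrow> x \<epsilon> X \<and> (\<forall>K. m_closed_in X T K \<and> m_subset A K \<longrightarrow> x \<epsilon> K))"

lemma holds_is_closure [simp]:
  "X < length l \<Longrightarrow> T < length l \<Longrightarrow> C < length l \<Longrightarrow> A < length l \<Longrightarrow>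
    holds (\<epsilon>) v l (is_closure X T C A) \<longleftrightarrow> m_is_closure (l ! X) (l ! T) (l ! C) (l ! A)"
  by (simp add: is_closure_def m_is_closure_def)

definition m_is_base :: "'a \<Rightarrow> 'a \<Rightarrow> bool" where
  "m_is_base B T \<longleftrightarrow>
    (m_subset B T \<and> (\<forall>U x. U \<epsilon> T \<and> x \<epsilon> U \<longrightarrow> (\<exists>V. V \<epsilon> B \<and> x \<epsilon> V \<and> m_subset V U)))"

lemma holds_is_base [simp]:
  "B < length l \<Longrightarrow> T < length l \<Longrightarrow>
    holds (\<epsilon>) v l (is_base B T) \<longleftrightarrow> m_is_base (l ! B) (l ! T)"
  by (simp add: is_base_def m_is_base_def)

definition m_G_delta :: "'a \<Rightarrow> 'a \<Rightarrow> bool" where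
  "m_G_delta T G \<longleftrightarrow>
    (\<exists>w F. m_is_omega w \<and> m_function_to F w T \<and>
    (\<forall>x. x \<epsilon> G \<longleftrightarrow> (\<forall>n U. n \<epsilon> w \<and> m_rel F n U \<longrightarrow> x \<epsilon> U)))"

lemma holds_G_delta [simp]:
  "T < length l \<Longrightarrow> G < length l \<Longrightarrow>
    holds (\<epsilon>) v l (G_delta T G) \<longleftrightarrow> m_G_delta (l ! T) (l ! G)"
  by (simp add: G_delta_def m_G_delta_def)

definition m_P_space :: "'a \<Rightarrow> 'a \<Rightarrow> bool" where
  "m_P_space X T \<longleftrightarrow>
    (m_topology X T \<and> (\<forall>G. m_G_delta T G \<longrightarrow> G \<epsilon> T))"

lemma holds_P_space [simp]:
  "X < length l \<Longrightarrow> T < length l \<Longrightarrow>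
    holds (\<epsilon>) v l (P_space X T) \<longleftrightarrow> m_P_space (l ! X) (l ! T)"
  by (simp add: P_space_def m_P_space_def)

definition m_regular :: "'a \<Rightarrow> 'a \<Rightarrow> bool" where
  "m_regular X T \<longleftrightarrow>
    (m_topology X T \<and>
    (\<forall>x V. V \<epsilon> T \<and> x \<epsilon> V \<longrightarrow>
      (\<exists>U C. U \<epsilon> T \<and> x \<epsilon> U \<and> m_is_closure X T C U \<and> m_subset C V)))"

lemma holds_regular [simp]:
  "X < length l \<Longrightarrow> T < length l \<Longrightarrow>
    holds (\<epsilon>) v l (regular X T) \<longleftrightarrow> m_regular (l ! X) (l ! T)"
  by (simp add: regular_def m_regular_def)

definition m_zero_dimensional :: "'a \<Rightarrow> 'a \<Rightarrow> bool" where
  "m_zero_dimensional X T \<longleftrightarrow>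
    (m_topology X T \<and>
    (\<exists>B. (\<forall>U. U \<epsilon> B \<longleftrightarrow> m_clopen_in X T U) \<and> m_is_base B T))"

lemma holds_zero_dimensional [simp]:
  "X < length l \<Longrightarrow> T < length l \<Longrightarrow>
    holds (\<epsilon>) v l (zero_dimensional X T) \<longleftrightarrow> m_zero_dimensional (l ! X) (l ! T)"
  by (simp add: zero_dimensional_def m_zero_dimensional_def)

definition m_operation_on :: "'a \<Rightarrow> 'a \<Rightarrow> bool" where
  "m_operation_on f A \<longleftrightarrow>
    (\<exists>D. (\<forall>p. p \<epsilon> D \<longleftrightarrow> (\<exists>x y. x \<epsilon> A \<and> y \<epsilon> A \<and> m_is_pair p x y)) \<and>
    m_function_to f D A)"

lemma holds_operation_on [simp]:
  "f < length l \<Longrightarrow> A < length l \<Longrightarrow>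
    holds (\<epsilon>) v l (operation_on f A) \<longleftrightarrow> m_operation_on (l ! f) (l ! A)"
  by (simp add: operation_on_def m_operation_on_def)

definition m_op :: "'a \<Rightarrow> 'a \<Rightarrow> 'a \<Rightarrow> 'a \<Rightarrow> bool" where
  "m_op f x y z \<longleftrightarrow>
    (\<exists>p. m_is_pair p x y \<and> m_rel f p z)"

lemma holds_op [simp]:
  "f < length l \<Longrightarrow> x < length l \<Longrightarrow> y < length l \<Longrightarrow> z < length l \<Longrightarrow>
    holds (\<epsilon>) v l (op f x y z) \<longleftrightarrow> m_op (l ! f) (l ! x) (l ! y) (l ! z)"
  by (simp add: op_def m_op_def)

definition m_assoc_comm_unit :: "'a \<Rightarrow> 'a \<Rightarrow> 'a \<Rightarrow> bool" where
  "m_assoc_comm_unit A f e \<longleftrightarrow>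
    (m_operation_on f A \<and> e \<epsilon> A \<and>
     (\<forall>x y z u v s t. m_op f x y u \<and> m_op f u z s \<and> m_op f y z v \<and> m_op f x v t \<longrightarrow> s = t) \<and>
     (\<forall>x y u. m_op f x y u \<longrightarrow> m_op f y x u) \<and>
     (\<forall>x. x \<epsilon> A \<longrightarrow> m_op f e x x))"

lemma holds_assoc_comm_unit [simp]:
  "A < length l \<Longrightarrow> f < length l \<Longrightarrow> e < length l \<Longrightarrow>
    holds (\<epsilon>) v l (assoc_comm_unit A f e) \<longleftrightarrow> m_assoc_comm_unit (l ! A) (l ! f) (l ! e)"
  by (simp add: assoc_comm_unit_def m_assoc_comm_unit_def)

definition m_ordered_field :: "'a \<Rightarrow> 'a \<Rightarrow> 'a \<Rightarrow> 'a \<Rightarrow> 'a \<Rightarrow> 'a \<Rightarrow> bool" where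
  "m_ordered_field A add mul zero one lt \<longleftrightarrow>
    (m_assoc_comm_unit A add zero \<and> m_assoc_comm_unit A mul one \<and> \<not> zero = one \<and>
     (\<forall>x. x \<epsilon> A \<longrightarrow> (\<exists>y. y \<epsilon> A \<and> m_op add x y zero)) \<and>
     (\<forall>x. x \<epsilon> A \<and> \<not> x = zero \<longrightarrow> (\<exists>y. y \<epsilon> A \<and> m_op mul x y one)) \<and>
     (\<forall>x y z u v r s t. m_op add y z u \<and> m_op mul x u v \<and>
        m_op mul x y r \<and> m_op mul x z s \<and> m_op add r s t \<longrightarrow> v = t) \<and>
     m_relation_on lt A \<and>
     (\<forall>x. \<not> m_rel lt x x) \<and>
     (\<forall>x y z. m_rel lt x y \<and> m_rel lt y z \<longrightarrow> m_rel lt x z) \<and>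
     (\<forall>x y. x \<epsilon> A \<and> y \<epsilon> A \<longrightarrow> m_rel lt x y \<or> x = y \<or> m_rel lt y x) \<and>
     (\<forall>x y z u v. m_rel lt x y \<and> m_op add x z u \<and> m_op add y z v \<longrightarrow> m_rel lt u v) \<and>
     (\<forall>x y u. m_rel lt zero x \<and> m_rel lt zero y \<and> m_op mul x y u \<longrightarrow> m_rel lt zero u))"

lemma holds_ordered_field [simp]:
  "A < length l \<Longrightarrow> add < length l \<Longrightarrow> mul < length l \<Longrightarrow> zero < length l \<Longrightarrow> one < length l \<Longrightarrow> lt <
    length l \<Longrightarrow>
    holds (\<epsilon>) v l (ordered_field A add mul zero one lt) \<longleftrightarrow> m_ordered_field (l ! A) (l ! add) (l ! mul) (l ! zero) (l ! one) (l ! lt)"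
  by (simp add: ordered_field_def m_ordered_field_def)

definition m_upper_bound :: "'a \<Rightarrow> 'a \<Rightarrow> 'a \<Rightarrow> 'a \<Rightarrow> bool" where
  "m_upper_bound A lt S b \<longleftrightarrow>
    (b \<epsilon> A \<and> (\<forall>x. x \<epsilon> S \<longrightarrow> m_rel lt x b \<or> x = b))"

lemma holds_upper_bound [simp]:
  "A < length l \<Longrightarrow> lt < length l \<Longrightarrow> S < length l \<Longrightarrow> b < length l \<Longrightarrow>
    holds (\<epsilon>) v l (upper_bound A lt S b) \<longleftrightarrow> m_upper_bound (l ! A) (l ! lt) (l ! S) (l ! b)"
  by (simp add: upper_bound_def m_upper_bound_def)

definition m_complete_order :: "'a \<Rightarrow> 'a \<Rightarrow> bool" where
  "m_complete_order A lt \<longleftrightarrow>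
    (\<forall>S. m_subset S A \<and> m_nonempty S \<and> (\<exists>b. m_upper_bound A lt S b) \<longrightarrow>
      (\<exists>b. m_upper_bound A lt S b \<and> (\<forall>c. m_upper_bound A lt S c \<longrightarrow> m_rel lt b c \<or> b = c)))"

lemma holds_complete_order [simp]:
  "A < length l \<Longrightarrow> lt < length l \<Longrightarrow>
    holds (\<epsilon>) v l (complete_order A lt) \<longleftrightarrow> m_complete_order (l ! A) (l ! lt)"
  by (simp add: complete_order_def m_complete_order_def)

definition m_is_reals :: "'a \<Rightarrow> 'a \<Rightarrow> 'a \<Rightarrow> 'a \<Rightarrow> 'a \<Rightarrow> 'a \<Rightarrow> bool" where
  "m_is_reals A add mul zero one lt \<longleftrightarrow>
    (m_ordered_field A add mul zero one lt \<and> m_complete_order A lt)"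

lemma holds_is_reals [simp]:
  "A < length l \<Longrightarrow> add < length l \<Longrightarrow> mul < length l \<Longrightarrow> zero < length l \<Longrightarrow> one < length l \<Longrightarrow> lt <
    length l \<Longrightarrow>
    holds (\<epsilon>) v l (is_reals A add mul zero one lt) \<longleftrightarrow> m_is_reals (l ! A) (l ! add) (l ! mul) (l ! zero) (l ! one) (l ! lt)"
  by (simp add: is_reals_def m_is_reals_def)

definition m_open_interval :: "'a \<Rightarrow> 'a \<Rightarrow> 'a \<Rightarrow> 'a \<Rightarrow> bool" where
  "m_open_interval lt I a b \<longleftrightarrow>
    (\<forall>x. x \<epsilon> I \<longleftrightarrow> m_rel lt a x \<and> m_rel lt x b)"

lemma holds_open_interval [simp]:
  "lt < length l \<Longrightarrow> I < length l \<Longrightarrow> a < length l \<Longrightarrow> b < length l \<Longrightarrow>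
    holds (\<epsilon>) v l (open_interval lt I a b) \<longleftrightarrow> m_open_interval (l ! lt) (l ! I) (l ! a) (l ! b)"
  by (simp add: open_interval_def m_open_interval_def)

definition m_open_reals :: "'a \<Rightarrow> 'a \<Rightarrow> 'a \<Rightarrow> bool" where
  "m_open_reals A lt V \<longleftrightarrow>
    (m_subset V A \<and>
    (\<forall>y. y \<epsilon> V \<longrightarrow> (\<exists>a b I. m_open_interval lt I a b \<and> y \<epsilon> I \<and> m_subset I V)))"

lemma holds_open_reals [simp]:
  "A < length l \<Longrightarrow> lt < length l \<Longrightarrow> V < length l \<Longrightarrow>
    holds (\<epsilon>) v l (open_reals A lt V) \<longleftrightarrow> m_open_reals (l ! A) (l ! lt) (l ! V)"
  by (simp add: open_reals_def m_open_reals_def)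

definition m_is_preimage :: "'a \<Rightarrow> 'a \<Rightarrow> 'a \<Rightarrow> bool" where
  "m_is_preimage U f V \<longleftrightarrow>
    (\<forall>x. x \<epsilon> U \<longleftrightarrow> (\<exists>y. y \<epsilon> V \<and> m_rel f x y))"

lemma holds_is_preimage [simp]:
  "U < length l \<Longrightarrow> f < length l \<Longrightarrow> V < length l \<Longrightarrow>
    holds (\<epsilon>) v l (is_preimage U f V) \<longleftrightarrow> m_is_preimage (l ! U) (l ! f) (l ! V)"
  by (simp add: is_preimage_def m_is_preimage_def)

definition m_continuous_to_reals :: "'a \<Rightarrow> 'a \<Rightarrow> 'a \<Rightarrow> 'a \<Rightarrow> 'a \<Rightarrow> bool" where
  "m_continuous_to_reals A lt X T f \<longleftrightarrow>
    (m_function_to f X A \<and>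
    (\<forall>V U. m_open_reals A lt V \<and> m_is_preimage U f V \<longrightarrow> U \<epsilon> T))"

lemma holds_continuous_to_reals [simp]:
  "A < length l \<Longrightarrow> lt < length l \<Longrightarrow> X < length l \<Longrightarrow> T < length l \<Longrightarrow> f < length l \<Longrightarrow>
    holds (\<epsilon>) v l (continuous_to_reals A lt X T f) \<longleftrightarrow> m_continuous_to_reals (l ! A) (l ! lt) (l ! X) (l ! T) (l ! f)"
  by (simp add: continuous_to_reals_def m_continuous_to_reals_def)

definition m_zero_set :: "'a \<Rightarrow> 'a \<Rightarrow> 'a \<Rightarrow> 'a \<Rightarrow> 'a \<Rightarrow> 'a \<Rightarrow> bool" where
  "m_zero_set A zero lt X T Z \<longleftrightarrow>
    (\<exists>f. m_continuous_to_reals A lt X T f \<and>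
    (\<forall>x. x \<epsilon> Z \<longleftrightarrow> m_rel f x zero))"

lemma holds_zero_set [simp]:
  "A < length l \<Longrightarrow> zero < length l \<Longrightarrow> lt < length l \<Longrightarrow> X < length l \<Longrightarrow> T < length l \<Longrightarrow> Z <
    length l \<Longrightarrow>
    holds (\<epsilon>) v l (zero_set A zero lt X T Z) \<longleftrightarrow> m_zero_set (l ! A) (l ! zero) (l ! lt) (l ! X) (l ! T) (l ! Z)"
  by (simp add: zero_set_def m_zero_set_def)

definition m_completely_regular :: "'a \<Rightarrow> 'a \<Rightarrow> 'a \<Rightarrow> 'a \<Rightarrow> 'a \<Rightarrow> bool" where
  "m_completely_regular A zero lt X T \<longleftrightarrow>
    (m_topology X T \<and>
    (\<exists>B. (\<forall>U. U \<epsilon> B \<longleftrightarrow> (\<exists>Z. m_zero_set A zero lt X T Z \<and> m_is_diff U X Z)) \<and> m_is_base B T))"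

lemma holds_completely_regular [simp]:
  "A < length l \<Longrightarrow> zero < length l \<Longrightarrow> lt < length l \<Longrightarrow> X < length l \<Longrightarrow> T < length l \<Longrightarrow>
    holds (\<epsilon>) v l (completely_regular A zero lt X T) \<longleftrightarrow> m_completely_regular (l ! A) (l ! zero) (l ! lt) (l ! X) (l ! T)"
  by (simp add: completely_regular_def m_completely_regular_def)

definition m_strongly_zero_dimensional :: "'a \<Rightarrow> 'a \<Rightarrow> 'a \<Rightarrow> 'a \<Rightarrow> 'a \<Rightarrow> bool" where
  "m_strongly_zero_dimensional A zero lt X T \<longleftrightarrow>
    (m_completely_regular A zero lt X T \<and>
    (\<forall>Z Z'. m_zero_set A zero lt X T Z \<and> m_zero_set A zero lt X T Z' \<and> m_disjoint Z Z' \<longrightarrow>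
      (\<exists>U D. m_clopen_in X T U \<and> m_is_diff D X Z' \<and> m_subset Z U \<and> m_subset U D)))"

lemma holds_strongly_zero_dimensional [simp]:
  "A < length l \<Longrightarrow> zero < length l \<Longrightarrow> lt < length l \<Longrightarrow> X < length l \<Longrightarrow> T < length l \<Longrightarrow>
    holds (\<epsilon>) v l (strongly_zero_dimensional A zero lt X T) \<longleftrightarrow> m_strongly_zero_dimensional (l ! A) (l ! zero) (l ! lt) (l ! X) (l ! T)"
  by (simp add: strongly_zero_dimensional_def m_strongly_zero_dimensional_def)

end

text \<open>Separation is assumed for formulas with parameters, not for HOL predicates: the latter
  would be second-order separation, which models of the first-order theory need not satisfy.\<close>

locale zf = membership +
  assumes ext: "(\<And>x. x \<epsilon> a \<longleftrightarrow> x \<epsilon> b) \<Longrightarrow> a = b"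
    and upair_exists: "\<exists>c. m_is_upair c a b"
    and Union_exists: "\<exists>u. m_is_Union u A"
    and powerset_exists: "\<exists>P. \<forall>x. x \<epsilon> P \<longleftrightarrow> m_subset x a"
    and sat_separation: "\<exists>b. \<forall>x. x \<epsilon> b \<longleftrightarrow> x \<epsilon> a \<and> sat (=) (\<epsilon>) (case_nat x e) p"

section \<open>Models of ZF\<close>

lemma closed_fm_All_pow: "closed_fm n p \<Longrightarrow> closed_fm 0 ((All ^^ n) p)"
proof -
  have "closed_fm (m + n) p \<Longrightarrow> closed_fm m ((All ^^ n) p)" for m
    by (induction n arbitrary: m) auto
  from this[of 0] show "closed_fm n p \<Longrightarrow> ?thesis" by simp
qed

lemma closed_ZF: "p \<in> ZF \<Longrightarrow> closed_fm 0 p"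
  by (auto simp: ZF_def closures_def closed_fm_All_pow extensionality_def foundation_def
        pairing_def union_axiom_def powerset_def infinity_def nonempty_def disjoint_def
        is_upair_def is_Union_def subset_def successor_closed_def is_succ_def
        fAll_def fEx_def fNot_def fAnd_def fOr_def fIff_def fImp_def fMem_def fEq_def)

text \<open>Recovers an axiom instance with free parameters from its universal closure, for every
  assignment of the parameters.\<close>

lemma sat_closure: "(\<forall>e. sat eq mem e ((All ^^ n) p)) \<Longrightarrow> sat eq mem e p"
proof (induction n arbitrary: e p)
  case (Suc n)
  have "(All ^^ Suc n) p = (All ^^ n) (All p)" by (simp add: funpow_swap1)
  with Suc.prems have "sat eq mem (\<lambda>i. e (Suc i)) (All p)" by (intro Suc.IH) metis
  then have "sat eq mem (case_nat (e 0) (\<lambda>i. e (Suc i))) p" by simp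
  moreover have "case_nat (e 0) (\<lambda>i. e (Suc i)) = e" by (auto split: nat.split)
  ultimately show ?case by simp
qed simp

text \<open>With \<open>h\<close> numbering the classes of \<open>eq\<close>, surjectivity makes the
  quantifiers on both sides range over the same objects.\<close>

lemma sat_quotient:
  assumes "surj h" "\<And>i j. h i = h j \<longleftrightarrow> eq i j" "\<And>i j. mem' (h i) (h j) \<longleftrightarrow> mem i j"
  shows "sat (=) mem' (\<lambda>i. h (e i)) p \<longleftrightarrow> sat eq mem e p"
proof (induction p arbitrary: e)
  case (All p)
  have *: "(\<lambda>i. h (case_nat d e i)) = case_nat (h d) (\<lambda>i. h (e i))" for d
    by (auto split: nat.split)
  have "sat (=) mem' (\<lambda>i. h (e i)) (All p) \<longleftrightarrow> (\<forall>d. sat (=) mem' (case_nat (h d) (\<lambda>i. h (e i))) p)"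
    using assms(1) by (metis sat.simps(5) surj_def)
  then show ?case using All[of "case_nat _ e"] by (simp add: *)
qed (simp_all add: assms)

lemma zf_if_sat:
  fixes mem :: "'a \<Rightarrow> 'a \<Rightarrow> bool"
  assumes "\<And>p e. p \<in> ZF \<Longrightarrow> sat (=) mem e p"
  shows "zf mem"
proof -
  interpret membership mem .
  have ax: "holds mem e [] P" if "P 0 \<in> ZF" for e P
    using assms[OF that] by (simp add: holds_def)
  show ?thesis
  proof
    fix a b assume "\<And>x. mem x a \<longleftrightarrow> mem x b"
    with ax[of extensionality] show "a = b" by (simp add: ZF_def extensionality_def)
  next
    fix a b show "\<exists>c. m_is_upair c a b"
      using ax[of pairing] by (simp add: ZF_def pairing_def)
  next
    fix A show "\<exists>u. m_is_Union u A"
      using ax[of union_axiom] by (simp add: ZF_def union_axiom_def)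
  next
    fix a show "\<exists>P. \<forall>x. mem x P \<longleftrightarrow> m_subset x a"
      using ax[of powerset] by (simp add: ZF_def powerset_def)
  next
    fix a e p
    obtain n where "closed_fm n (separation p 0)" using closed_fm_exists by blast
    then have "(All ^^ n) (separation p 0) \<in> ZF" by (auto simp: ZF_def closures_def)
    then have "\<forall>e. sat (=) mem e ((All ^^ n) (separation p 0))" by (simp add: assms)
    from sat_closure[OF this, of e] have "holds mem e [] (separation p)"
      by (simp add: holds_def)
    then show "\<exists>b. \<forall>x. mem x b \<longleftrightarrow> mem x a \<and> sat (=) mem (case_nat x e) p"
      by (simp add: separation_def)
  qed
qed

text \<open>If \<open>r\<close> took finitely many values, pairing and union would collect all of
  them in one set \<open>u\<close>. As everything equals some value of \<open>r\<close>,
  \<open>u\<close> would contain itself, and the singleton of \<open>u\<close> would violate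
  foundation.\<close>

lemma ZF_model_infinite:
  assumes cong: "congruence eq mem" and "\<And>p e. p \<in> ZF \<Longrightarrow> sat eq mem e p"
    and r: "\<And>x. eq x (r x)"
  shows "infinite (range r)"
proof
  have refl: "eq x x" for x using cong by (simp add: congruence_def equivp_reflp)
  have sym: "eq y x" if "eq x y" for x y using cong that by (simp add: congruence_def equivp_symp)
  have mem_cong: "mem x' y'" if "mem x y" "eq x x'" "eq y y'" for x y x' y'
    using cong that unfolding congruence_def by blast
  note fm_defs = fAll_def fEx_def fNot_def fAnd_def fOr_def fIff_def fImp_def fMem_def fEq_def
  have pairing: "\<exists>c. \<forall>x. mem x c \<longleftrightarrow> eq x a \<or> eq x b" for a b
    using assms(2)[of "pairing 0"]
    by (simp add: ZF_def pairing_def is_upair_def fm_defs) blast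
  have union: "\<exists>u. \<forall>x. mem x u \<longleftrightarrow> (\<exists>a. mem a A \<and> mem x a)" for A
    using assms(2)[of "union_axiom 0"]
    by (simp add: ZF_def union_axiom_def is_Union_def fm_defs) blast
  have foundation: "\<exists>x. mem x a \<and> \<not> (\<exists>y. mem y x \<and> mem y a)" if "mem z a" for a z
    using assms(2)[of "foundation 0"] that
    by (simp add: ZF_def foundation_def nonempty_def disjoint_def fm_defs) blast
  assume "finite (range r)"
  moreover have "\<exists>u. \<forall>x\<in>S. mem x u" if "finite S" for S
    using that
  proof induction
    case (insert x S)
    then obtain u where u: "\<forall>y\<in>S. mem y u" by blast
    obtain s where s: "\<And>y. mem y s \<longleftrightarrow> eq y x \<or> eq y x" using pairing by blast
    obtain c where c: "\<And>y. mem y c \<longleftrightarrow> eq y s \<or> eq y u" using pairing by blast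
    obtain v where "\<And>y. mem y v \<longleftrightarrow> (\<exists>a. mem a c \<and> mem y a)" using union by blast
    with u s c show ?case by (intro exI[of _ v]) (auto intro: refl)
  qed simp
  ultimately obtain u where u: "\<forall>x\<in>range r. mem x u" by blast
  have self: "mem u u" using u mem_cong[OF _ sym[OF r] refl] by blast
  obtain s where s: "\<And>x. mem x s \<longleftrightarrow> eq x u \<or> eq x u" using pairing by blast
  then obtain x where x: "mem x s" "\<not> (\<exists>y. mem y x \<and> mem y s)"
    using foundation[of u s] refl by blast
  then have "mem u x" using self s mem_cong sym refl by blast
  with x(2) s refl show False by blast
qed

text \<open>Bridge between the syntactic and the semantic half: the congruence model from
  completeness becomes a model on \<open>nat\<close> with true equality, in which the sentence can
  be read as an ordinary statement about \<open>mem\<close>.\<close>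

lemma ZF_proves:
  assumes "\<And>(mem :: nat \<Rightarrow> nat \<Rightarrow> bool) e. zf mem \<Longrightarrow> holds mem e [] P"
  shows "ZF \<^bold>\<turnstile> P"
  unfolding proves_def
proof (rule completeness[OF closed_ZF])
  fix eq mem :: "nat \<Rightarrow> nat \<Rightarrow> bool" and e :: "nat \<Rightarrow> nat"
  assume cong: "congruence eq mem" and sat: "\<And>q e. q \<in> ZF \<Longrightarrow> sat eq mem e q"
  have equiv: "equivp eq"
    and mem_cong: "\<And>x x' y y'. eq x x' \<Longrightarrow> eq y y' \<Longrightarrow> mem x y \<Longrightarrow> mem x' y'"
    using cong unfolding congruence_def by blast+
  define r where "r x = (LEAST y. eq x y)" for x
  have r: "eq x (r x)" for x
    unfolding r_def by (rule LeastI[of _ x]) (simp add: equivp_reflp[OF equiv])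
  have r_eq: "r x = r y \<longleftrightarrow> eq x y" for x y
  proof
    show "r x = r y \<Longrightarrow> eq x y" using r[of x] r[of y] equiv by (metis equivp_def)
    show "eq x y \<Longrightarrow> r x = r y" using equiv by (simp add: r_def equivp_def)
  qed
  \<comment> \<open>Least representatives form an infinite set of natural numbers; enumerating them
    turns the quotient into a structure on all of \<open>nat\<close> again.\<close>
  define h where "h x = to_nat_on (range r) (r x)" for x
  have bij: "bij_betw (to_nat_on (range r)) (range r) UNIV"
    by (rule to_nat_on_infinite) (use ZF_model_infinite[OF cong sat r] in auto)
  have h: "surj h" "h x = h y \<longleftrightarrow> eq x y" for x y
    using bij unfolding h_def r_eq[symmetric]
    by (auto simp: bij_betw_def image_image inj_on_def)
  define mem' where "mem' a b \<longleftrightarrow> (\<exists>x y. h x = a \<and> h y = b \<and> mem x y)" for a b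
  have mem': "mem' (h x) (h y) \<longleftrightarrow> mem x y" for x y
    unfolding mem'_def h(2) using mem_cong equivp_reflp[OF equiv] by blast
  note quotient = sat_quotient[of h eq mem' mem, OF h(1) h(2) mem']
  have "zf mem'"
  proof (rule zf_if_sat)
    fix p and e :: "nat \<Rightarrow> nat"
    assume "p \<in> ZF"
    have "(\<lambda>i. h (inv h (e i))) = e" using h(1) by (simp add: surj_f_inv_f)
    with quotient[of "\<lambda>i. inv h (e i)" p] sat[OF \<open>p \<in> ZF\<close>] show "sat (=) mem' e p" by simp
  qed
  from assms[OF this, of "\<lambda>i. h (e i)"] show "sat eq mem e (P 0)"
    by (simp add: holds_def quotient)
qed

section \<open>Set theory in a model\<close>

context zf
begin

text \<open>
  The predicate has to be given by a formula \<open>P\<close>; its numerals below point to positions in the list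
  \<open>l @ [x]\<close> of values.
\<close>

lemma separation:
  assumes "\<And>x. Q x \<longleftrightarrow> holds (\<epsilon>) undefined (l @ [x]) P"
  obtains b where "\<And>x. x \<epsilon> b \<longleftrightarrow> x \<epsilon> a \<and> Q x"
proof -
  define e where "e i = (if i < length l then l ! (length l - Suc i) else undefined (i - length l))" for i
  have "case_nat x e = (\<lambda>i. if i < length (l @ [x]) then (l @ [x]) ! (length (l @ [x]) - Suc i)
      else undefined (i - length (l @ [x])))" for x
    by (auto simp: e_def fun_eq_iff nth_append split: nat.split)
  then have "Q x \<longleftrightarrow> sat (=) (\<epsilon>) (case_nat x e) (P (Suc (length l)))" for x
    by (simp add: assms holds_def)
  then show ?thesis using sat_separation[of a e "P (Suc (length l))"] that by auto
qed

section \<open>Pairs, relations and functions inside the model\<close>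

definition upair :: "'a \<Rightarrow> 'a \<Rightarrow> 'a" where
  "upair x y = (THE c. m_is_upair c x y)"

lemma is_upair_iff: "m_is_upair c x y \<longleftrightarrow> c = upair x y"
proof -
  obtain d where d: "m_is_upair d x y" using upair_exists by blast
  have unique: "c = d" if "m_is_upair c x y" for c
    using that d by (intro ext) (simp add: m_is_upair_def)
  then have "upair x y = d" unfolding upair_def using d by (rule the_equality[rotated])
  with d unique show ?thesis by blast
qed

lemma mem_upair [simp]: "z \<epsilon> upair x y \<longleftrightarrow> z = x \<or> z = y"
  using is_upair_iff[of "upair x y" x y] by (simp add: m_is_upair_def)

definition pair :: "'a \<Rightarrow> 'a \<Rightarrow> 'a" where
  "pair x y = upair (upair x x) (upair x y)"

lemma is_pair_iff [simp]: "m_is_pair p x y \<longleftrightarrow> p = pair x y"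
  by (simp add: m_is_pair_def is_upair_iff pair_def)

lemma upair_eq_iff: "upair x y = upair u v \<longleftrightarrow> x = u \<and> y = v \<or> x = v \<and> y = u"
proof
  assume "upair x y = upair u v"
  then have "z = x \<or> z = y \<longleftrightarrow> z = u \<or> z = v" for z by (metis mem_upair)
  then show "x = u \<and> y = v \<or> x = v \<and> y = u" by metis
qed (auto intro: ext)

lemma pair_inject [simp]: "pair x y = pair u v \<longleftrightarrow> x = u \<and> y = v"
  by (auto simp: pair_def upair_eq_iff)

lemma rel_iff: "m_rel r x y \<longleftrightarrow> pair x y \<epsilon> r"
  by (simp add: m_rel_def)

text \<open>A pair of elements of the union of \<open>A\<close> and \<open>B\<close> lies in the
  second power set of that union, which bounds the separation. The pair \<open>p\<close> takes the
  position \<open>length l\<close>, so the two arguments of \<open>Q\<close> sit at the next two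
  positions; this explains the numerals in later uses.\<close>

lemma relation_exists:
  assumes holds: "\<And>p x y. Q x y \<longleftrightarrow> holds (\<epsilon>) undefined (l @ [p, x, y]) P"
    and bound: "\<And>x y. Q x y \<Longrightarrow> x \<epsilon> A \<and> y \<epsilon> B"
  obtains r where "\<And>p. p \<epsilon> r \<longleftrightarrow> (\<exists>x y. p = pair x y \<and> Q x y)"
proof -
  obtain C where C: "m_is_Union C (upair A B)" using Union_exists by blast
  obtain C1 where C1: "\<And>x. x \<epsilon> C1 \<longleftrightarrow> m_subset x C" using powerset_exists by blast
  obtain C2 where C2: "\<And>x. x \<epsilon> C2 \<longleftrightarrow> m_subset x C1" using powerset_exists by blast
  have "pair x y \<epsilon> C2" if "Q x y" for x y
    using bound[OF that] C by (auto simp: C2 C1 m_subset_def m_is_Union_def pair_def)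
  moreover obtain r where "\<And>p. p \<epsilon> r \<longleftrightarrow> p \<epsilon> C2 \<and> (\<exists>x y. Q x y \<and> p = pair x y)"
    by (rule separation[of "\<lambda>p. \<exists>x y. Q x y \<and> p = pair x y" l
          "\<^bold>\<exists>x y. P \<^bold>\<and> is_pair (length l) x y" C2]) (auto simp: holds[symmetric])
  ultimately show ?thesis using that[of r] by blast
qed

lemma function_exists:
  assumes "\<And>p x y. Q x y \<longleftrightarrow> holds (\<epsilon>) undefined (l @ [p, x, y]) P"
    and "\<And>x y. Q x y \<Longrightarrow> x \<epsilon> A \<and> y \<epsilon> B"
    and "\<And>x. x \<epsilon> A \<Longrightarrow> \<exists>y. Q x y"
    and "\<And>x y z. Q x y \<Longrightarrow> Q x z \<Longrightarrow> y = z"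
  obtains f where "m_function_to f A B" "\<And>x y. m_rel f x y \<longleftrightarrow> Q x y"
proof -
  obtain f where f: "\<And>p. p \<epsilon> f \<longleftrightarrow> (\<exists>x y. p = pair x y \<and> Q x y)"
    by (rule relation_exists[OF assms(1,2)]) blast+
  have rel: "m_rel f x y \<longleftrightarrow> Q x y" for x y by (simp add: rel_iff f)
  have "m_function_to f A B"
    unfolding m_function_to_def m_function_on_def is_pair_iff rel f using assms(2,3,4) by blast
  then show ?thesis using that rel by blast
qed

lemma function_toD:
  assumes "m_function_to f A B"
  shows "\<And>x y. m_rel f x y \<Longrightarrow> x \<epsilon> A \<and> y \<epsilon> B"
    and "\<And>x. x \<epsilon> A \<Longrightarrow> \<exists>y. m_rel f x y"
    and "\<And>x y z. m_rel f x y \<Longrightarrow> m_rel f x z \<Longrightarrow> y = z"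
  using assms unfolding m_function_to_def m_function_on_def is_pair_iff rel_iff by (metis pair_inject)+

section \<open>The set omega inside the model\<close>

lemma omegaD:
  assumes "m_is_omega w"
  shows "\<exists>n. n \<epsilon> w" and "n \<epsilon> w \<Longrightarrow> \<exists>s. s \<epsilon> w \<and> m_is_succ s n"
proof -
  note w = assms[unfolded m_is_omega_def m_successor_closed_def, THEN conjunct1]
  show "\<exists>n. n \<epsilon> w" using w[THEN conjunct1] by blast
  show "n \<epsilon> w \<Longrightarrow> \<exists>s. s \<epsilon> w \<and> m_is_succ s n" using w[THEN conjunct2] by blast
qed

text \<open>Induction in the model: the elements of \<open>w\<close> that are subsets of
  \<open>w\<close> form a successor-closed set, and \<open>w\<close> is the least such set.\<close>

lemma omega_transitive:
  assumes w: "m_is_omega w" and n: "n \<epsilon> w" "m \<epsilon> n"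
  shows "m \<epsilon> w"
proof -
  obtain I where I: "\<And>n. n \<epsilon> I \<longleftrightarrow> n \<epsilon> w \<and> m_subset n w"
    by (rule separation[of "\<lambda>n. m_subset n w" "[w]" "1 \<^bold>\<subseteq> 0" w]) auto
  have "m_successor_closed I"
    unfolding m_successor_closed_def
  proof (intro conjI allI impI)
    have w': "m_successor_closed w" using w by (simp add: m_is_omega_def)
    then show "\<exists>e. e \<epsilon> I \<and> \<not> m_nonempty e"
      by (auto simp: m_successor_closed_def I m_nonempty_def m_subset_def)
    fix n assume n: "n \<epsilon> I"
    with w' obtain s where "s \<epsilon> w" "m_is_succ s n" by (auto simp: m_successor_closed_def I)
    with n show "\<exists>s. s \<epsilon> I \<and> m_is_succ s n"
      by (auto simp: I m_subset_def m_is_succ_def)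
  qed
  with w have "m_subset w I" by (simp add: m_is_omega_def)
  with n I show ?thesis by (auto simp: m_subset_def)
qed

section \<open>Intersections of open sets in P-spaces\<close>

lemma topologyD:
  assumes "m_topology X T"
  shows "U \<epsilon> T \<Longrightarrow> z \<epsilon> U \<Longrightarrow> z \<epsilon> X" and "X \<epsilon> T"
    and "m_subset S T \<Longrightarrow> m_is_Union V S \<Longrightarrow> V \<epsilon> T"
proof -
  note T = assms[unfolded m_topology_def]
  note 1 = T[THEN conjunct1] and 2 = T[THEN conjunct2, THEN conjunct1]
    and 3 = T[THEN conjunct2, THEN conjunct2, THEN conjunct2]
  show "X \<epsilon> T" by (rule 2)
  show "U \<epsilon> T \<Longrightarrow> z \<epsilon> U \<Longrightarrow> z \<epsilon> X" using 1 by (simp add: m_subset_def)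
  show "m_subset S T \<Longrightarrow> m_is_Union V S \<Longrightarrow> V \<epsilon> T" by (rule 3[rule_format, OF conjI])
qed

text \<open>\<open>N\<close> is the union of all its open subsets. Collecting all of them, instead
  of one neighbourhood for each point, avoids a choice.\<close>

lemma open_if_nhds:
  assumes T: "m_topology X T"
    and N: "\<And>y. y \<epsilon> N \<Longrightarrow> \<exists>U. U \<epsilon> T \<and> y \<epsilon> U \<and> m_subset U N"
  shows "N \<epsilon> T"
proof -
  obtain S where S: "\<And>U. U \<epsilon> S \<longleftrightarrow> U \<epsilon> T \<and> m_subset U N"
    by (rule separation[of "\<lambda>U. m_subset U N" "[N]" "1 \<^bold>\<subseteq> 0" T]) auto
  have "m_subset S T" "m_is_Union N S"
    using N unfolding m_subset_def m_is_Union_def S by blast+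
  then show ?thesis by (rule topologyD(3)[OF T])
qed

text \<open>
  A finite set is an image of some \<open>n \<epsilon> w\<close>, so the intersection becomes a \<open>G_delta\<close> set
  when the family is extended to all of \<open>w\<close> by \<open>X\<close>: no induction on \<open>n\<close> is needed.
\<close>

lemma P_space_finite_inter:
  assumes P: "m_P_space X T" and A: "m_finite_set A" "m_subset A E" and g: "m_function_to g E T"
    and W: "\<And>z. z \<epsilon> W \<longleftrightarrow> z \<epsilon> X \<and> (\<forall>x U. x \<epsilon> A \<and> m_rel g x U \<longrightarrow> z \<epsilon> U)"
  shows "W \<epsilon> T"
proof -
  from P have T: "m_topology X T" by (simp add: m_P_space_def)
  from A obtain w n f where w: "m_is_omega w" "n \<epsilon> w" and f: "m_bijection f n A"
    by (auto simp: m_finite_set_def)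
  from f have fn: "m_function_to f n A" and onto: "\<And>y. y \<epsilon> A \<Longrightarrow> \<exists>x. m_rel f x y"
    by (auto simp: m_bijection_def)
  define Q where "Q m U \<longleftrightarrow> m \<epsilon> w \<and>
    (m \<epsilon> n \<and> (\<exists>x. m_rel f m x \<and> m_rel g x U) \<or> \<not> m \<epsilon> n \<and> U = X)" for m U
  have AE: "x \<epsilon> A \<Longrightarrow> x \<epsilon> E" for x using A by (auto simp: m_subset_def)
  obtain h where h: "m_function_to h w T" "\<And>m U. m_rel h m U \<longleftrightarrow> Q m U"
  proof (rule function_exists[of Q "[w, n, f, g, X]" "6 \<^bold>\<in> 0 \<^bold>\<and>
    (6 \<^bold>\<in> 1 \<^bold>\<and> (\<^bold>\<exists>x. rel 2 6 x \<^bold>\<and> rel 3 x 7) \<^bold>\<or> \<^bold>\<not> 6 \<^bold>\<in> 1 \<^bold>\<and> 7 \<^bold>= 4)" w T])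
    show "Q m U \<Longrightarrow> m \<epsilon> w \<and> U \<epsilon> T" for m U
      unfolding Q_def using function_toD[OF g] topologyD(1,2)[OF T] by blast
    show "m \<epsilon> w \<Longrightarrow> \<exists>U. Q m U" for m
      unfolding Q_def using function_toD(2)[OF g] function_toD(1,2)[OF fn] AE by metis
    show "Q m U \<Longrightarrow> Q m V \<Longrightarrow> U = V" for m U V
      unfolding Q_def using function_toD(3)[OF g] function_toD(3)[OF fn] by metis
  qed (auto simp: Q_def)
  have "z \<epsilon> W \<longleftrightarrow> (\<forall>m U. m \<epsilon> w \<and> m_rel h m U \<longrightarrow> z \<epsilon> U)" for z
  proof
    assume "z \<epsilon> W"
    then show "\<forall>m U. m \<epsilon> w \<and> m_rel h m U \<longrightarrow> z \<epsilon> U"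
      unfolding W h Q_def using function_toD(1)[OF fn] by blast
  next
    assume *: "\<forall>m U. m \<epsilon> w \<and> m_rel h m U \<longrightarrow> z \<epsilon> U"
    show "z \<epsilon> W" unfolding W
    proof (intro conjI allI impI)
      \<comment> \<open>\<open>G_delta\<close> does not mention \<open>X\<close>. Membership in
        \<open>X\<close> comes from the value at some index, an open set, and \<open>n\<close> is an
        index at hand.\<close>
      obtain U where "m_rel h n U" using function_toD(2)[OF h(1)] w by blast
      then show "z \<epsilon> X" using * w function_toD(1)[OF h(1)] topologyD(1,2)[OF T] by blast
      fix x U assume xU: "x \<epsilon> A \<and> m_rel g x U"
      then obtain m where "m_rel f m x" using onto by blast
      moreover from this have "m \<epsilon> n" using function_toD(1)[OF fn] by blast
      moreover from this have "m \<epsilon> w" using w omega_transitive by blast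
      ultimately show "z \<epsilon> U" using * xU unfolding h Q_def by blast
    qed
  qed
  with w h(1) have "m_G_delta T W" unfolding m_G_delta_def by blast
  with P show ?thesis by (auto simp: m_P_space_def)
qed

text \<open>\<open>D\<close> is the union of the finite sets given by WDC, so a successor in the
  next set stays in \<open>D\<close>. Indices and open sets are kept apart by \<open>g\<close>, so
  that one lemma serves both applications: for neighbourhoods \<open>g\<close> is the identity, for
  positive reals x it yields the preimage of the interval (-x, x).\<close>

lemma WDC_open_inter:
  assumes WDC: "m_WDC" and P: "m_P_space X T" and g: "m_function_to g E T"
    and E: "m_nonempty E" "m_relation_on R E" "\<And>x. x \<epsilon> E \<Longrightarrow> \<exists>y. y \<epsilon> E \<and> m_rel R x y"
  obtains D W where "m_nonempty D" "m_subset D E" "\<And>x. x \<epsilon> D \<Longrightarrow> \<exists>y. y \<epsilon> D \<and> m_rel R x y"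
    "W \<epsilon> T" "\<And>z. z \<epsilon> W \<longleftrightarrow> z \<epsilon> X \<and> (\<forall>x U. x \<epsilon> D \<and> m_rel g x U \<longrightarrow> z \<epsilon> U)"
proof -
  from P have T: "m_topology X T" by (simp add: m_P_space_def)
  have "m_nonempty E \<and> m_relation_on R E \<and> (\<forall>x. x \<epsilon> E \<longrightarrow> (\<exists>y. y \<epsilon> E \<and> m_rel R x y))"
    using E by blast
  from WDC[unfolded m_WDC_def, THEN spec, THEN spec, THEN mp, OF this]
  obtain w F where w: "m_is_omega w" and F: "m_function_on F w"
    and F_fin': "\<forall>n A. n \<epsilon> w \<and> m_rel F n A \<longrightarrow> m_nonempty A \<and> m_finite_set A \<and> m_subset A E"
    and F_step': "\<forall>n m A B. n \<epsilon> w \<and> m_is_succ m n \<and> m_rel F n A \<and> m_rel F m B \<longrightarrow>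
        (\<forall>x. x \<epsilon> A \<longrightarrow> (\<exists>y. y \<epsilon> B \<and> m_rel R x y))"
    by (elim exE conjE)
  have F_fin: "m_nonempty A \<and> m_finite_set A \<and> m_subset A E" if "n \<epsilon> w" "m_rel F n A" for n A
    using F_fin' that by blast
  have F_step: "\<exists>y. y \<epsilon> B \<and> m_rel R x y"
    if "n \<epsilon> w" "m_is_succ m n" "m_rel F n A" "m_rel F m B" "x \<epsilon> A" for n m A B x
    using F_step' that by blast
  have F_dom: "n \<epsilon> w" if "m_rel F n A" for n A
    using F that by (auto simp: m_function_on_def rel_iff)
  have F_ex: "\<exists>A. m_rel F n A" if "n \<epsilon> w" for n
    using F that by (auto simp: m_function_on_def)
  have F_un: "A = B" if "m_rel F n A" "m_rel F n B" for n A B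
    using F that unfolding m_function_on_def by blast
  obtain D where D: "\<And>x. x \<epsilon> D \<longleftrightarrow> x \<epsilon> E \<and> (\<exists>n A. m_rel F n A \<and> x \<epsilon> A)"
    by (rule separation[of "\<lambda>x. \<exists>n A. m_rel F n A \<and> x \<epsilon> A" "[F]" "\<^bold>\<exists>n A. rel 0 n A \<^bold>\<and> 1 \<^bold>\<in> A" E]) auto
  obtain W where W: "\<And>z. z \<epsilon> W \<longleftrightarrow> z \<epsilon> X \<and> (\<forall>x U. x \<epsilon> D \<and> m_rel g x U \<longrightarrow> z \<epsilon> U)"
    by (rule separation[of "\<lambda>z. \<forall>x U. x \<epsilon> D \<and> m_rel g x U \<longrightarrow> z \<epsilon> U" "[D, g]"
          "\<^bold>\<forall>x U. x \<^bold>\<in> 0 \<^bold>\<and> rel 1 x U \<^bold>\<longrightarrow> 2 \<^bold>\<in> U" X]) auto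
  \<comment> \<open>\<open>V\<close> is the intersection over the n-th finite set. It is determined
    by \<open>n\<close>, so these sets form a function on \<open>w\<close> without choice, and their
    intersection is a \<open>G_delta\<close> set.\<close>
  define Q where "Q n V \<longleftrightarrow> n \<epsilon> w \<and> V \<epsilon> T \<and> (\<exists>A. m_rel F n A \<and>
    (\<forall>z. z \<epsilon> V \<longleftrightarrow> z \<epsilon> X \<and> (\<forall>x U. x \<epsilon> A \<and> m_rel g x U \<longrightarrow> z \<epsilon> U)))" for n V
  obtain h where h: "m_function_to h w T" "\<And>m U. m_rel h m U \<longleftrightarrow> Q m U"
  proof (rule function_exists[of Q "[w, T, F, X, g]" "6 \<^bold>\<in> 0 \<^bold>\<and> 7 \<^bold>\<in> 1 \<^bold>\<and> (\<^bold>\<exists>A. rel 2 6 A \<^bold>\<and>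
    (\<^bold>\<forall>z. z \<^bold>\<in> 7 \<^bold>\<longleftrightarrow> z \<^bold>\<in> 3 \<^bold>\<and> (\<^bold>\<forall>x U. x \<^bold>\<in> A \<^bold>\<and> rel 4 x U \<^bold>\<longrightarrow> z \<^bold>\<in> U)))" w T])
    show "Q n V \<Longrightarrow> n \<epsilon> w \<and> V \<epsilon> T" for n V by (simp add: Q_def)
    show "\<exists>V. Q n V" if n: "n \<epsilon> w" for n
    proof -
      obtain A where A: "m_rel F n A" using F_ex n by blast
      obtain V where V: "\<And>z. z \<epsilon> V \<longleftrightarrow> z \<epsilon> X \<and> (\<forall>x U. x \<epsilon> A \<and> m_rel g x U \<longrightarrow> z \<epsilon> U)"
        by (rule separation[of "\<lambda>z. \<forall>x U. x \<epsilon> A \<and> m_rel g x U \<longrightarrow> z \<epsilon> U" "[A, g]"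
              "\<^bold>\<forall>x U. x \<^bold>\<in> 0 \<^bold>\<and> rel 1 x U \<^bold>\<longrightarrow> 2 \<^bold>\<in> U" X]) auto
      have "V \<epsilon> T" using F_fin[OF n A] by (intro P_space_finite_inter[OF P _ _ g V]) auto
      with n A V show ?thesis by (auto simp: Q_def)
    qed
    show "Q n V \<Longrightarrow> Q n V' \<Longrightarrow> V = V'" for n V V'
      unfolding Q_def by (intro ext) (metis F_un)
  qed (auto simp: Q_def)
  note wn = omegaD(1)[OF w]
  have DE: "m_subset D E" by (simp add: D m_subset_def)
  have inD: "x \<epsilon> D" if "m_rel F n A" "x \<epsilon> A" for n A x
    using F_fin[OF F_dom[OF that(1)] that(1)] that unfolding D m_subset_def by blast
  have "z \<epsilon> W \<longleftrightarrow> (\<forall>n V. n \<epsilon> w \<and> m_rel h n V \<longrightarrow> z \<epsilon> V)" for z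
  proof
    assume "z \<epsilon> W"
    then show "\<forall>n V. n \<epsilon> w \<and> m_rel h n V \<longrightarrow> z \<epsilon> V"
      unfolding h Q_def W using inD by blast
  next
    assume *: "\<forall>n V. n \<epsilon> w \<and> m_rel h n V \<longrightarrow> z \<epsilon> V"
    \<comment> \<open>Some index is needed here: \<open>z\<close> lies in \<open>X\<close> because
      it lies in one of the open sets.\<close>
    obtain n V where "n \<epsilon> w" "m_rel h n V" using wn function_toD(2)[OF h(1)] by blast
    then have "z \<epsilon> X" using * function_toD(1)[OF h(1)] topologyD(1,2)[OF T] by blast
    moreover have "z \<epsilon> U" if xU: "x \<epsilon> D" "m_rel g x U" for x U
    proof -
      obtain n A where nA: "m_rel F n A" "x \<epsilon> A" using xU D by blast
      then obtain V where V: "m_rel h n V" using F_dom function_toD(2)[OF h(1)] by blast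
      then have "z \<epsilon> V" using * F_dom nA by blast
      then show ?thesis using V nA xU F_un unfolding h Q_def by blast
    qed
    ultimately show "z \<epsilon> W" unfolding W by blast
  qed
  with w h(1) have "m_G_delta T W" unfolding m_G_delta_def by blast
  with P have "W \<epsilon> T" by (auto simp: m_P_space_def)
  moreover have "m_nonempty D"
  proof -
    obtain n A where "n \<epsilon> w" "m_rel F n A" using wn F_ex by blast
    then show ?thesis using F_fin[of n A] inD unfolding m_nonempty_def by blast
  qed
  moreover have "\<exists>y. y \<epsilon> D \<and> m_rel R x y" if xD: "x \<epsilon> D" for x
  proof -
    obtain n A where nA: "m_rel F n A" "x \<epsilon> A" using xD D by blast
    then obtain m where m: "m \<epsilon> w" "m_is_succ m n"
      using F_dom omegaD(2)[OF w] by blast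
    then obtain B where "m_rel F m B" using F_ex by blast
    with nA m show ?thesis using F_step[OF F_dom[OF nA(1)] m(2) nA(1) _ nA(2)] inD by blast
  qed
  ultimately show ?thesis using that DE W by blast
qed

section \<open>Regular P-spaces\<close>

text \<open>By extensionality a collection is determined by its members, so a set \<open>B'\<close>
  required to consist of all objects with a property can be replaced by the one already
  constructed.\<close>

lemma ex_set_iff:
  assumes "\<And>U. U \<epsilon> B \<longleftrightarrow> P U"
  shows "(\<exists>B'. (\<forall>U. U \<epsilon> B' \<longleftrightarrow> P U) \<and> R B') \<longleftrightarrow> R B"
proof -
  have "(\<forall>U. U \<epsilon> B' \<longleftrightarrow> P U) \<longleftrightarrow> B' = B" for B'
    using assms by (auto intro: ext)
  then show ?thesis by simp
qed

lemma regularD: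
  assumes "m_regular X T" "V \<epsilon> T" "x \<epsilon> V"
  shows "\<exists>U C. U \<epsilon> T \<and> x \<epsilon> U \<and> m_is_closure X T C U \<and> m_subset C V"
  using assms(1)[unfolded m_regular_def, THEN conjunct2] assms(2,3) by blast

lemma zero_dimensional_iff:
  "m_zero_dimensional X T \<longleftrightarrow> m_topology X T \<and>
    (\<forall>V x. V \<epsilon> T \<and> x \<epsilon> V \<longrightarrow> (\<exists>U. m_clopen_in X T U \<and> x \<epsilon> U \<and> m_subset U V))"
proof -
  obtain B where B: "\<And>U. U \<epsilon> B \<longleftrightarrow> U \<epsilon> T \<and> m_clopen_in X T U"
    by (rule separation[of "m_clopen_in X T" "[X, T]" "clopen_in 0 1 2" T]) auto
  then have B': "U \<epsilon> B \<longleftrightarrow> m_clopen_in X T U" for U by (auto simp: m_clopen_in_def)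
  have "m_is_base B T \<longleftrightarrow>
    (\<forall>V x. V \<epsilon> T \<and> x \<epsilon> V \<longrightarrow> (\<exists>U. m_clopen_in X T U \<and> x \<epsilon> U \<and> m_subset U V))"
    unfolding m_is_base_def B' by (simp add: m_subset_def B)
  with ex_set_iff[OF B'] show ?thesis by (simp add: m_zero_dimensional_def)
qed

lemma regular_P_space_zero_dimensional:
  assumes WDC: "m_WDC" and reg: "m_regular X T" and P: "m_P_space X T"
  shows "m_zero_dimensional X T"
proof -
  have T: "m_topology X T" using P by (simp add: m_P_space_def)
  have "\<exists>W. m_clopen_in X T W \<and> x \<epsilon> W \<and> m_subset W V" if V: "V \<epsilon> T" "x \<epsilon> V" for x V
  proof -
    obtain E where E: "\<And>U. U \<epsilon> E \<longleftrightarrow> U \<epsilon> T \<and> (x \<epsilon> U \<and> m_subset U V)"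
      by (rule separation[of "\<lambda>U. x \<epsilon> U \<and> m_subset U V" "[x, V]" "0 \<^bold>\<in> 2 \<^bold>\<and> 2 \<^bold>\<subseteq> 1" T]) auto
    define Q where "Q U U' \<longleftrightarrow> U \<epsilon> E \<and> U' \<epsilon> E \<and> (\<exists>C. m_is_closure X T C U' \<and> m_subset C U)" for U U'
    obtain R where R: "\<And>p. p \<epsilon> R \<longleftrightarrow> (\<exists>U U'. p = pair U U' \<and> Q U U')"
      by (rule relation_exists[of Q "[E, X, T]" "4 \<^bold>\<in> 0 \<^bold>\<and> 5 \<^bold>\<in> 0 \<^bold>\<and>
            (\<^bold>\<exists>C. is_closure 1 2 C 5 \<^bold>\<and> C \<^bold>\<subseteq> 4)" E E]) (auto simp: Q_def)
    have rel_R: "m_rel R U U' \<longleftrightarrow> Q U U'" for U U' by (simp add: rel_iff R)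
    \<comment> \<open>Here the indices are themselves open sets, hence the identity.\<close>
    obtain g where g: "m_function_to g E T" "\<And>U U'. m_rel g U U' \<longleftrightarrow> U \<epsilon> E \<and> U' = U"
      by (rule function_exists[of "\<lambda>U U'. U \<epsilon> E \<and> U' = U" "[E]" "2 \<^bold>\<in> 0 \<^bold>\<and> 3 \<^bold>= 2" E T]) (auto simp: E)
    have ne: "m_nonempty E" using V by (auto simp: m_nonempty_def E m_subset_def)
    have R_on: "m_relation_on R E" by (auto simp: m_relation_on_def R Q_def)
    have R_total: "\<exists>U'. U' \<epsilon> E \<and> m_rel R U U'" if U: "U \<epsilon> E" for U
    proof -
      obtain U' C where U': "U' \<epsilon> T" "x \<epsilon> U'" "m_is_closure X T C U'" "m_subset C U"
        using regularD[OF reg, of U x] U E by blast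
      \<comment> \<open>A set lies in its closure, so \<open>U'\<close> is inside \<open>U\<close>
        and hence inside \<open>V\<close>; the relation never leaves the neighbourhoods in
        \<open>E\<close>.\<close>
      have "m_subset U' C"
        using U'(3) topologyD(1)[OF T U'(1)] unfolding m_is_closure_def m_subset_def by blast
      then have "U' \<epsilon> E" using U' U unfolding E m_subset_def by blast
      with U U' show ?thesis unfolding rel_R Q_def by blast
    qed
    obtain D W where D: "m_nonempty D" "m_subset D E" "\<And>U. U \<epsilon> D \<Longrightarrow> \<exists>U'. U' \<epsilon> D \<and> m_rel R U U'"
      and W_open: "W \<epsilon> T" and W: "\<And>z. z \<epsilon> W \<longleftrightarrow> z \<epsilon> X \<and> (\<forall>U U'. U \<epsilon> D \<and> m_rel g U U' \<longrightarrow> z \<epsilon> U')"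
      by (rule WDC_open_inter[OF WDC P g(1) ne R_on R_total], assumption) (rule that)
    have D_E: "U \<epsilon> E" if "U \<epsilon> D" for U using D(2) that by (simp add: m_subset_def)
    have W': "z \<epsilon> W \<longleftrightarrow> z \<epsilon> X \<and> (\<forall>U. U \<epsilon> D \<longrightarrow> z \<epsilon> U)" for z
      unfolding W g using D_E by blast
    have xX: "x \<epsilon> X" using topologyD(1)[OF T] V by blast
    have x: "x \<epsilon> W" unfolding W' using xX D_E E by blast
    have WV: "m_subset W V" using D(1) D_E E unfolding m_subset_def W' m_nonempty_def by blast
    obtain N where N: "\<And>z. z \<epsilon> N \<longleftrightarrow> z \<epsilon> X \<and> \<not> z \<epsilon> W"
      by (rule separation[of "\<lambda>z. \<not> z \<epsilon> W" "[W]" "\<^bold>\<not> 1 \<^bold>\<in> 0" X]) auto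
    have "N \<epsilon> T"
    proof (rule open_if_nhds[OF T])
      fix y assume y: "y \<epsilon> N"
      then obtain U where U: "U \<epsilon> D" "\<not> y \<epsilon> U" and yX: "y \<epsilon> X" using N W' by blast
      from D(3)[OF U(1)] obtain U' C where U': "U' \<epsilon> D" and C: "m_is_closure X T C U'" "m_subset C U"
        unfolding rel_R Q_def by blast
      \<comment> \<open>The closure is the intersection of the closed supersets, so a point outside
        it is omitted by some closed \<open>K\<close> containing \<open>U'\<close>. The complement
        of \<open>K\<close> is then an open neighbourhood of \<open>y\<close> disjoint from
        \<open>U'\<close>, hence from \<open>W\<close>.\<close>
      have "\<not> y \<epsilon> C" using C(2) U(2) by (auto simp: m_subset_def)
      then obtain K where K: "m_closed_in X T K" "m_subset U' K" "\<not> y \<epsilon> K"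
        using C(1) yX unfolding m_is_closure_def by blast
      then obtain O' where O': "O' \<epsilon> T" "m_is_diff O' X K" by (auto simp: m_closed_in_def)
      have "y \<epsilon> O'" using O'(2) K(3) yX by (simp add: m_is_diff_def)
      moreover have "m_subset O' N"
        using O'(2) K(2) U' unfolding m_subset_def N m_is_diff_def W' by blast
      ultimately show "\<exists>U. U \<epsilon> T \<and> y \<epsilon> U \<and> m_subset U N" using O'(1) by blast
    qed
    moreover have "m_is_diff N X W" "m_subset W X"
      using N by (auto simp: m_is_diff_def m_subset_def W')
    ultimately have "m_clopen_in X T W"
      using W_open by (auto simp: m_clopen_in_def m_closed_in_def)
    with x WV show ?thesis by blast
  qed
  with T show ?thesis by (simp add: zero_dimensional_iff)
qed

end

section \<open>Arithmetic of the real line\<close>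

locale zf_reals = zf +
  fixes A add mul zero one lt
  assumes reals: "m_is_reals A add mul zero one lt"
begin

definition val :: "'a \<Rightarrow> 'a \<Rightarrow> 'a \<Rightarrow> 'a" where
  "val f x y = (THE z. m_op f x y z)"

text \<open>The field axioms speak of graphs of operations. This equivalence eliminates the graph
  variables, so that they can be used as equations between values of \<open>val\<close>.\<close>

lemma op_iff:
  assumes "m_operation_on f A"
  shows "m_op f x y z \<longleftrightarrow> x \<epsilon> A \<and> y \<epsilon> A \<and> z = val f x y"
    and "x \<epsilon> A \<Longrightarrow> y \<epsilon> A \<Longrightarrow> val f x y \<epsilon> A"
proof -
  from assms obtain D
    where "(\<forall>p. p \<epsilon> D \<longleftrightarrow> (\<exists>x y. x \<epsilon> A \<and> y \<epsilon> A \<and> m_is_pair p x y)) \<and> m_function_to f D A"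
    unfolding m_operation_on_def by (rule exE)
  note D = this[THEN conjunct1, THEN spec, unfolded is_pair_iff] and f = this[THEN conjunct2]
  have op: "m_op f x y z \<longleftrightarrow> m_rel f (pair x y) z" for x y z by (simp add: m_op_def)
  have D_iff: "pair x y \<epsilon> D \<longleftrightarrow> x \<epsilon> A \<and> y \<epsilon> A" for x y by (simp add: D)
  have val: "m_rel f (pair x y) (val f x y)" if xy: "x \<epsilon> A" "y \<epsilon> A" for x y
  proof -
    obtain z where z: "m_rel f (pair x y) z" using function_toD(2)[OF f] xy D_iff by blast
    then have "val f x y = z" unfolding val_def op
      by (rule the_equality) (rule function_toD(3)[OF f _ z])
    with z show ?thesis by simp
  qed
  show "m_op f x y z \<longleftrightarrow> x \<epsilon> A \<and> y \<epsilon> A \<and> z = val f x y"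
    unfolding op using val[of x y] function_toD(1,3)[OF f] D_iff by metis
  show "val f x y \<epsilon> A" if "x \<epsilon> A" "y \<epsilon> A"
    using function_toD(1)[OF f val[OF that]] by blast
qed

lemma assoc_comm_unitD:
  assumes "m_assoc_comm_unit A f e"
  shows "m_operation_on f A" and "e \<epsilon> A"
    and "x \<epsilon> A \<Longrightarrow> y \<epsilon> A \<Longrightarrow> z \<epsilon> A \<Longrightarrow> val f (val f x y) z = val f x (val f y z)"
    and "x \<epsilon> A \<Longrightarrow> y \<epsilon> A \<Longrightarrow> val f x y = val f y x"
    and "x \<epsilon> A \<Longrightarrow> val f e x = x"
proof -
  note a = assms[unfolded m_assoc_comm_unit_def]
  show o: "m_operation_on f A" using a by (rule conjunct1)
  note a = a[THEN conjunct2, unfolded op_iff(1)[OF o]]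
  show "e \<epsilon> A" using a by (rule conjunct1)
  note a = a[THEN conjunct2]
  show "val f (val f x y) z = val f x (val f y z)" if "x \<epsilon> A" "y \<epsilon> A" "z \<epsilon> A"
    using a[THEN conjunct1] op_iff(2)[OF o] that by metis
  note a = a[THEN conjunct2]
  show "val f x y = val f y x" if "x \<epsilon> A" "y \<epsilon> A"
    using a[THEN conjunct1] that by metis
  show "val f e x = x" if "x \<epsilon> A"
    using a[THEN conjunct2] that by metis
qed

abbreviation plus (infixl \<open>\<oplus>\<close> 65) where "x \<oplus> y \<equiv> val add x y"
abbreviation times (infixl \<open>\<otimes>\<close> 70) where "x \<otimes> y \<equiv> val mul x y"
abbreviation less (infix \<open>\<prec>\<close> 50) where "x \<prec> y \<equiv> m_rel lt x y"

lemma field: "m_ordered_field A add mul zero one lt"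
  using reals by (simp add: m_is_reals_def)

lemmas add_acu = field[unfolded m_ordered_field_def, THEN conjunct1]
  and mul_acu = field[unfolded m_ordered_field_def, THEN conjunct2, THEN conjunct1]

lemmas op_add = op_iff(1)[OF assoc_comm_unitD(1)[OF add_acu]]
  and op_mul = op_iff(1)[OF assoc_comm_unitD(1)[OF mul_acu]]

lemmas closed [simp, intro] = op_iff(2)[OF assoc_comm_unitD(1)[OF add_acu]]
  op_iff(2)[OF assoc_comm_unitD(1)[OF mul_acu]]
  assoc_comm_unitD(2)[OF add_acu] assoc_comm_unitD(2)[OF mul_acu]

lemmas add_assoc = assoc_comm_unitD(3)[OF add_acu]
  and add_comm = assoc_comm_unitD(4)[OF add_acu]
  and zero_add [simp] = assoc_comm_unitD(5)[OF add_acu]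
  and mul_comm = assoc_comm_unitD(4)[OF mul_acu]
  and one_mul [simp] = assoc_comm_unitD(5)[OF mul_acu]

lemma field_axioms:
  shows zero_neq_one: "zero \<noteq> one"
    and neg_exists: "x \<epsilon> A \<Longrightarrow> \<exists>y. y \<epsilon> A \<and> x \<oplus> y = zero"
    and inv_exists: "x \<epsilon> A \<Longrightarrow> x \<noteq> zero \<Longrightarrow> \<exists>y. y \<epsilon> A \<and> x \<otimes> y = one"
    and distrib: "x \<epsilon> A \<Longrightarrow> y \<epsilon> A \<Longrightarrow> z \<epsilon> A \<Longrightarrow> x \<otimes> (y \<oplus> z) = x \<otimes> y \<oplus> x \<otimes> z"
    and less_closed: "x \<prec> y \<Longrightarrow> x \<epsilon> A \<and> y \<epsilon> A"
    and less_irrefl: "\<not> x \<prec> x"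
    and less_trans: "x \<prec> y \<Longrightarrow> y \<prec> z \<Longrightarrow> x \<prec> z"
    and less_total: "x \<epsilon> A \<Longrightarrow> y \<epsilon> A \<Longrightarrow> x \<prec> y \<or> x = y \<or> y \<prec> x"
    and add_less: "x \<prec> y \<Longrightarrow> z \<epsilon> A \<Longrightarrow> x \<oplus> z \<prec> y \<oplus> z"
proof -
  note f = field[unfolded m_ordered_field_def op_add op_mul, THEN conjunct2, THEN conjunct2]
  show "zero \<noteq> one" by (rule f[THEN conjunct1])
  note f = f[THEN conjunct2]
  show "\<exists>y. y \<epsilon> A \<and> x \<oplus> y = zero" if "x \<epsilon> A" using f[THEN conjunct1] that by metis
  note f = f[THEN conjunct2]
  show "\<exists>y. y \<epsilon> A \<and> x \<otimes> y = one" if "x \<epsilon> A" "x \<noteq> zero" using f[THEN conjunct1] that by metis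
  note f = f[THEN conjunct2]
  show "x \<otimes> (y \<oplus> z) = x \<otimes> y \<oplus> x \<otimes> z" if "x \<epsilon> A" "y \<epsilon> A" "z \<epsilon> A"
    using f[THEN conjunct1] that closed(1,2) by metis
  note f = f[THEN conjunct2]
  have less_closed: "x \<epsilon> A \<and> y \<epsilon> A" if "x \<prec> y" for x y
    using f[THEN conjunct1] that unfolding m_relation_on_def rel_iff is_pair_iff by (metis pair_inject)
  then show "x \<prec> y \<Longrightarrow> x \<epsilon> A \<and> y \<epsilon> A" .
  note f = f[THEN conjunct2]
  show "\<not> x \<prec> x" using f[THEN conjunct1] by blast
  note f = f[THEN conjunct2]
  show "x \<prec> z" if "x \<prec> y" "y \<prec> z" using f[THEN conjunct1] that by blast
  note f = f[THEN conjunct2]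
  show "x \<prec> y \<or> x = y \<or> y \<prec> x" if "x \<epsilon> A" "y \<epsilon> A" using f[THEN conjunct1] that by blast
  note f = f[THEN conjunct2]
  show "x \<oplus> z \<prec> y \<oplus> z" if "x \<prec> y" "z \<epsilon> A"
    using f[THEN conjunct1] that less_closed by metis
qed

text \<open>One of \<open>one\<close> and its additive inverse is positive and the other negative,
  whichever sign \<open>one\<close> has.\<close>

lemma pos_neg_exist:
  obtains p n where "zero \<prec> p" "n \<prec> zero"
proof -
  obtain y where y: "y \<epsilon> A" "one \<oplus> y = zero" using neg_exists[of one] by auto
  have "zero \<prec> one \<or> one \<prec> zero" using less_total[of zero one] zero_neq_one by simp
  then show ?thesis
    using that[of one y] that[of y one] add_less[of zero one y] add_less[of one zero y] y by auto
qed

lemma no_endpoints: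
  assumes "z \<epsilon> A"
  obtains a b where "a \<prec> z" "z \<prec> b"
proof -
  obtain p n where "zero \<prec> p" "n \<prec> zero" by (rule pos_neg_exist)
  then show ?thesis
    using that[of "n \<oplus> z" "p \<oplus> z"] add_less[of zero p z] add_less[of n zero z] assms by simp
qed

lemma half_exists:
  assumes "zero \<prec> x"
  obtains y where "zero \<prec> y" "y \<oplus> y = x"
proof -
  have x: "x \<epsilon> A" using less_closed assms by blast
  \<comment> \<open>Doubling moves \<open>one\<close> further away from \<open>zero\<close> on its
    own side; both signs are covered.\<close>
  have "one \<oplus> one \<noteq> zero"
    using add_less[of zero one one] add_less[of one zero one] less_total[of zero one] zero_neq_one
      less_trans less_irrefl by (metis closed(3,4) zero_add)
  then obtain h where h: "h \<epsilon> A" "(one \<oplus> one) \<otimes> h = one"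
    using inv_exists[of "one \<oplus> one"] by auto
  have "h \<oplus> h = one"
    using h distrib[of h one one] mul_comm[of h one] mul_comm[of h "one \<oplus> one"] by simp
  then have y: "x \<otimes> h \<oplus> x \<otimes> h = x"
    using distrib[of x h h] mul_comm[of x one] h x by simp
  have yA: "x \<otimes> h \<epsilon> A" using x h by simp
  \<comment> \<open>The sign of the half is inferred from its double: twice zero is zero, and twice
    a negative element is negative, but the double is the positive \<open>x\<close>.\<close>
  have "zero \<prec> x \<otimes> h"
  proof (rule ccontr)
    assume "\<not> zero \<prec> x \<otimes> h"
    then consider "x \<otimes> h = zero" | "x \<otimes> h \<prec> zero" using less_total[OF yA, of zero] by auto
    then show False
    proof cases
      case 1
      then show ?thesis using y assms less_irrefl by simp
    next
      case 2
      then have "x \<prec> zero" using add_less[OF 2 yA] y yA less_trans by (metis zero_add)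
      then show ?thesis using assms less_trans less_irrefl by blast
    qed
  qed
  with y that show ?thesis by blast
qed

lemma interval_exists:
  obtains I where "m_open_interval lt I a b" "m_open_reals A lt I"
proof -
  obtain I where I: "\<And>x. x \<epsilon> I \<longleftrightarrow> x \<epsilon> A \<and> (a \<prec> x \<and> x \<prec> b)"
    by (rule separation[of "\<lambda>x. a \<prec> x \<and> x \<prec> b" "[lt, a, b]" "rel 0 1 3 \<^bold>\<and> rel 0 3 2" A]) auto
  then have I': "m_open_interval lt I a b"
    using less_closed unfolding m_open_interval_def by blast
  moreover have "m_open_reals A lt I"
    unfolding m_open_reals_def using I I' by (auto simp: m_subset_def)
  ultimately show ?thesis by (rule that)
qed

lemma nonzero_open:
  assumes S: "\<And>x. x \<epsilon> S \<longleftrightarrow> x \<epsilon> A \<and> x \<noteq> zero"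
  shows "m_open_reals A lt S"
  unfolding m_open_reals_def
proof (intro conjI allI impI)
  show "m_subset S A" by (simp add: m_subset_def S)
  fix y assume "y \<epsilon> S"
  then have y: "y \<epsilon> A" "y \<noteq> zero" by (simp_all add: S)
  obtain a b where ab: "a \<prec> y" "y \<prec> b" using no_endpoints[OF y(1)] by blast
  \<comment> \<open>On the side of \<open>y\<close> that faces zero, the endpoint is zero
    itself.\<close>
  have "\<exists>a b. a \<prec> y \<and> y \<prec> b \<and> \<not> (a \<prec> zero \<and> zero \<prec> b)"
    using less_total[of y zero] y ab less_irrefl by (metis closed(3))
  then obtain a b where "a \<prec> y" "y \<prec> b" "\<not> (a \<prec> zero \<and> zero \<prec> b)" by blast
  moreover obtain I where "m_open_interval lt I a b" using interval_exists by blast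
  moreover from this calculation have "y \<epsilon> I" "m_subset I S"
    using less_closed unfolding m_open_interval_def m_subset_def S by blast+
  ultimately show "\<exists>a b I. m_open_interval lt I a b \<and> y \<epsilon> I \<and> m_subset I S" by blast
qed

section \<open>Preimages and complements of zero-sets\<close>

lemma continuous_preimage:
  assumes f: "m_continuous_to_reals A lt X T f" and V: "m_open_reals A lt V"
  obtains U where "U \<epsilon> T" "\<And>z. z \<epsilon> U \<longleftrightarrow> (\<exists>y. y \<epsilon> V \<and> m_rel f z y)"
proof -
  note f = f[unfolded m_continuous_to_reals_def]
  obtain U where "\<And>z. z \<epsilon> U \<longleftrightarrow> z \<epsilon> X \<and> (\<exists>y. y \<epsilon> V \<and> m_rel f z y)"
    by (rule separation[of "\<lambda>z. \<exists>y. y \<epsilon> V \<and> m_rel f z y" "[V, f]"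
          "\<^bold>\<exists>y. y \<^bold>\<in> 0 \<^bold>\<and> rel 1 2 y" X]) auto
  then have U: "z \<epsilon> U \<longleftrightarrow> (\<exists>y. y \<epsilon> V \<and> m_rel f z y)" for z
    using function_toD(1)[OF f[THEN conjunct1]] by blast
  then have "m_is_preimage U f V" by (simp add: m_is_preimage_def)
  then have "U \<epsilon> T" using f[THEN conjunct2] V by blast
  with U show ?thesis using that by blast
qed

lemma complement_zero_set_open:
  assumes "m_zero_set A zero lt X T Z" "m_is_diff U X Z"
  shows "U \<epsilon> T"
proof -
  obtain f where f: "m_continuous_to_reals A lt X T f" and Z: "\<And>x. x \<epsilon> Z \<longleftrightarrow> m_rel f x zero"
    using assms(1) unfolding m_zero_set_def by blast
  have fn: "m_function_to f X A" using f by (simp add: m_continuous_to_reals_def)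
  obtain S where S: "\<And>x. x \<epsilon> S \<longleftrightarrow> x \<epsilon> A \<and> x \<noteq> zero"
    by (rule separation[of "\<lambda>x. x \<noteq> zero" "[zero]" "\<^bold>\<not> 1 \<^bold>= 0" A]) auto
  obtain U' where U': "U' \<epsilon> T" "\<And>z. z \<epsilon> U' \<longleftrightarrow> (\<exists>y. y \<epsilon> S \<and> m_rel f z y)"
    using continuous_preimage[OF f nonzero_open[OF S]] by blast
  have "U = U'"
  proof (rule ext)
    fix z show "z \<epsilon> U \<longleftrightarrow> z \<epsilon> U'"
      using assms(2) function_toD[OF fn] unfolding m_is_diff_def U'(2) Z S by metis
  qed
  with U' show ?thesis by simp
qed

section \<open>Complete regularity and strong zero-dimensionality\<close>

lemma clopen_complement_zero_set:
  assumes T: "m_topology X T" and U: "m_clopen_in X T U"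
  obtains Z where "m_zero_set A zero lt X T Z" "m_is_diff U X Z"
proof -
  obtain Z where Z: "Z \<epsilon> T" "m_is_diff Z X U" and UT: "U \<epsilon> T"
    using U unfolding m_clopen_in_def m_closed_in_def by blast
  have UX: "x \<epsilon> U \<Longrightarrow> x \<epsilon> X" for x using topologyD(1)[OF T UT] .
  have Z_iff: "x \<epsilon> Z \<longleftrightarrow> x \<epsilon> X \<and> \<not> x \<epsilon> U" for x using Z(2) by (simp add: m_is_diff_def)
  obtain f where f: "m_function_to f X A"
    "\<And>x y. m_rel f x y \<longleftrightarrow> x \<epsilon> X \<and> (x \<epsilon> U \<and> y = one \<or> \<not> x \<epsilon> U \<and> y = zero)"
    by (rule function_exists[of "\<lambda>x y. x \<epsilon> X \<and> (x \<epsilon> U \<and> y = one \<or> \<not> x \<epsilon> U \<and> y = zero)"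
          "[X, U, one, zero]" "5 \<^bold>\<in> 0 \<^bold>\<and> (5 \<^bold>\<in> 1 \<^bold>\<and> 6 \<^bold>= 2 \<^bold>\<or> \<^bold>\<not> 5 \<^bold>\<in> 1 \<^bold>\<and> 6 \<^bold>= 3)" X A]) auto
  have "m_continuous_to_reals A lt X T f"
    unfolding m_continuous_to_reals_def
  proof (intro conjI allI impI f(1))
    fix V P assume "m_open_reals A lt V \<and> m_is_preimage P f V"
    then have P: "x \<epsilon> P \<longleftrightarrow> x \<epsilon> X \<and> (x \<epsilon> U \<and> one \<epsilon> V \<or> \<not> x \<epsilon> U \<and> zero \<epsilon> V)" for x
      unfolding m_is_preimage_def f(2) by blast
    show "P \<epsilon> T"
    proof (rule open_if_nhds[OF T])
      fix y assume "y \<epsilon> P"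
      \<comment> \<open>A preimage under this two-valued function is a union of some of the sets
        \<open>U\<close> and \<open>Z\<close>, both open.\<close>
      then have "y \<epsilon> U \<and> m_subset U P \<or> y \<epsilon> Z \<and> m_subset Z P"
        unfolding m_subset_def P Z_iff using UX by blast
      then show "\<exists>U. U \<epsilon> T \<and> y \<epsilon> U \<and> m_subset U P" using Z(1) UT by blast
    qed
  qed
  moreover have "x \<epsilon> Z \<longleftrightarrow> m_rel f x zero" for x
    unfolding f(2) Z_iff using zero_neq_one by auto
  ultimately have "m_zero_set A zero lt X T Z" unfolding m_zero_set_def by blast
  moreover have "m_is_diff U X Z" unfolding m_is_diff_def Z_iff using UX by blast
  ultimately show ?thesis by (rule that)
qed

text \<open>Complements of zero-sets are open, so they can be separated from \<open>T\<close> as one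
  set; every clopen set is among them, so this set inherits the base property.\<close>

lemma zero_dimensional_completely_regular:
  assumes "m_zero_dimensional X T"
  shows "m_completely_regular A zero lt X T"
proof -
  from assms have T: "m_topology X T"
    and base: "\<And>V x. V \<epsilon> T \<Longrightarrow> x \<epsilon> V \<Longrightarrow> \<exists>U. m_clopen_in X T U \<and> x \<epsilon> U \<and> m_subset U V"
    unfolding zero_dimensional_iff by blast+
  let ?co = "\<lambda>U. \<exists>Z. m_zero_set A zero lt X T Z \<and> m_is_diff U X Z"
  obtain B where "\<And>U. U \<epsilon> B \<longleftrightarrow> U \<epsilon> T \<and> ?co U"
    by (rule separation[of ?co "[A, zero, lt, X, T]"
          "\<^bold>\<exists>Z. zero_set 0 1 2 3 4 Z \<^bold>\<and> is_diff 5 3 Z" T]) auto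
  then have B: "U \<epsilon> B \<longleftrightarrow> ?co U" for U using complement_zero_set_open by blast
  have "m_is_base B T"
    unfolding m_is_base_def m_subset_def[of B] B
  proof (intro conjI allI impI)
    fix V x assume "V \<epsilon> T \<and> x \<epsilon> V"
    then obtain U where "m_clopen_in X T U" "x \<epsilon> U" "m_subset U V" using base by blast
    then show "\<exists>U. ?co U \<and> x \<epsilon> U \<and> m_subset U V"
      using clopen_complement_zero_set[OF T] by metis
  qed (use complement_zero_set_open in blast)
  with T B show ?thesis unfolding m_completely_regular_def by blast
qed

text \<open>
  The supremum \<open>s\<close> of the lower bounds of \<open>D\<close> is one of them, and since every element of \<open>D\<close>
  can be halved within \<open>D\<close>, so is \<open>s \<oplus> s\<close>; hence \<open>s\<close> is not positive.
\<close>

lemma halving_lower_bound: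
  assumes D: "m_nonempty D" "\<And>x. x \<epsilon> D \<Longrightarrow> x \<epsilon> A"
    and half: "\<And>x. x \<epsilon> D \<Longrightarrow> \<exists>y. y \<epsilon> D \<and> y \<oplus> y = x"
    and b: "\<And>x. x \<epsilon> D \<Longrightarrow> b \<prec> x"
  shows "\<not> zero \<prec> b"
proof
  assume pos: "zero \<prec> b"
  define le where "le x y \<longleftrightarrow> x \<prec> y \<or> x = y" for x y
  have le_trans: "le x z" if "le x y" "le y z" for x y z
    using that less_trans unfolding le_def by blast
  obtain d where d: "d \<epsilon> D" using D(1) by (auto simp: m_nonempty_def)
  obtain L where L: "\<And>x. x \<epsilon> L \<longleftrightarrow> x \<epsilon> A \<and> (\<forall>y. y \<epsilon> D \<longrightarrow> x \<prec> y \<or> x = y)"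
    by (rule separation[of "\<lambda>x. \<forall>y. y \<epsilon> D \<longrightarrow> x \<prec> y \<or> x = y" "[D, lt]"
          "\<^bold>\<forall>y. y \<^bold>\<in> 0 \<^bold>\<longrightarrow> rel 1 2 y \<^bold>\<or> 2 \<^bold>= y" A]) auto
  have upper: "m_upper_bound A lt L x \<longleftrightarrow> x \<epsilon> A \<and> (\<forall>y. y \<epsilon> L \<longrightarrow> le y x)" for x
    by (simp add: m_upper_bound_def le_def)
  have bL: "b \<epsilon> L" using b less_closed[OF pos] by (simp add: L)
  have D_upper: "m_upper_bound A lt L x" if "x \<epsilon> D" for x
    using D(2) that by (simp add: upper L le_def)
  have "m_subset L A \<and> m_nonempty L \<and> (\<exists>x. m_upper_bound A lt L x)"
    using bL D_upper[OF d] by (auto simp: m_subset_def m_nonempty_def L)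
  moreover have "m_complete_order A lt" using reals by (simp add: m_is_reals_def)
  ultimately obtain s where s: "m_upper_bound A lt L s" "\<And>c. m_upper_bound A lt L c \<Longrightarrow> le s c"
    unfolding m_complete_order_def le_def by blast
  have sA: "s \<epsilon> A" and bs: "le b s" using s(1) bL by (simp_all add: upper)
  have "le (s \<oplus> s) x" if x: "x \<epsilon> D" for x
  proof -
    obtain y where y: "y \<epsilon> D" "y \<oplus> y = x" using half x by blast
    then have sy: "le s y" using s(2) D_upper by blast
    have yA: "y \<epsilon> A" using D(2) y by blast
    have "s \<oplus> s \<prec> y \<oplus> y" if "s \<prec> y"
      using add_less[OF that sA] add_less[OF that yA] add_comm[OF sA yA] less_trans by metis
    with sy y(2) show ?thesis unfolding le_def by blast
  qed
  then have "s \<oplus> s \<epsilon> L" using sA by (simp add: L le_def)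
  then have "le (s \<oplus> s) s" using s(1) by (simp add: upper)
  moreover have "zero \<prec> s" using pos bs less_trans unfolding le_def by blast
  then have "s \<prec> s \<oplus> s" using add_less[of zero s s] sA by simp
  ultimately show False using less_trans less_irrefl unfolding le_def by metis
qed

text \<open>The preimages of (-x, x) for all x in \<open>D\<close> intersect exactly in
  \<open>Z\<close>: a value of \<open>f\<close> common to all these intervals, or else its negative,
  would be a positive strict lower bound of \<open>D\<close> if it were not zero.\<close>

lemma zero_set_open:
  assumes WDC: "m_WDC" and P: "m_P_space X T" and zero_set: "m_zero_set A zero lt X T Z"
  shows "Z \<epsilon> T"
proof -
  obtain f where f: "m_continuous_to_reals A lt X T f" and Z: "\<And>x. x \<epsilon> Z \<longleftrightarrow> m_rel f x zero"
    using zero_set unfolding m_zero_set_def by blast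
  have fn: "m_function_to f X A" using f by (simp add: m_continuous_to_reals_def)
  obtain E where E: "\<And>x. x \<epsilon> E \<longleftrightarrow> x \<epsilon> A \<and> zero \<prec> x"
    by (rule separation[of "\<lambda>x. zero \<prec> x" "[lt, zero]" "rel 0 1 2" A]) auto
  define Q where "Q x y \<longleftrightarrow> x \<epsilon> E \<and> y \<epsilon> E \<and> m_op add y y x" for x y
  obtain R where R: "\<And>p. p \<epsilon> R \<longleftrightarrow> (\<exists>x y. p = pair x y \<and> Q x y)"
    by (rule relation_exists[of Q "[E, add]" "3 \<^bold>\<in> 0 \<^bold>\<and> 4 \<^bold>\<in> 0 \<^bold>\<and> op 1 4 4 3" E E]) (auto simp: Q_def)
  have rel_R: "m_rel R x y \<longleftrightarrow> x \<epsilon> E \<and> y \<epsilon> E \<and> y \<oplus> y = x" for x y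
    by (auto simp: rel_iff R Q_def op_add E)
  \<comment> \<open>\<open>n\<close> is the additive inverse of \<open>x\<close>, so
    \<open>U\<close> consists of the points whose value lies strictly between -x and x.\<close>
  define G where "G x U \<longleftrightarrow> x \<epsilon> E \<and> U \<epsilon> T \<and> (\<forall>z. z \<epsilon> U \<longleftrightarrow>
    (\<exists>n c. m_op add x n zero \<and> m_rel f z c \<and> n \<prec> c \<and> c \<prec> x))" for x U
  obtain g where g: "m_function_to g E T" "\<And>x U. m_rel g x U \<longleftrightarrow> G x U"
  proof (rule function_exists[of G "[E, T, add, zero, f, lt]" "7 \<^bold>\<in> 0 \<^bold>\<and> 8 \<^bold>\<in> 1 \<^bold>\<and> (\<^bold>\<forall>z. z \<^bold>\<in> 8 \<^bold>\<longleftrightarrow>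
      (\<^bold>\<exists>n c. op 2 7 n 3 \<^bold>\<and> rel 4 z c \<^bold>\<and> rel 5 n c \<^bold>\<and> rel 5 c 7))" E T])
    show "G x U \<Longrightarrow> x \<epsilon> E \<and> U \<epsilon> T" for x U by (simp add: G_def)
    show "G x U \<Longrightarrow> G x V \<Longrightarrow> U = V" for x U V unfolding G_def by (intro ext) blast
    show "\<exists>U. G x U" if x: "x \<epsilon> E" for x
    proof -
      obtain n where n: "n \<epsilon> A" "x \<oplus> n = zero" using neg_exists x E by blast
      \<comment> \<open>\<open>G\<close> quantifies existentially over the inverse; uniqueness
        identifies it with the left endpoint of the chosen interval.\<close>
      have n_unique: "n' = n" if "n' \<epsilon> A" "x \<oplus> n' = zero" for n'
        using add_assoc[of n x n'] add_comm[of n x] add_comm[of n zero] that n x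
        by (simp add: E)
      obtain I where I: "m_open_interval lt I n x" "m_open_reals A lt I" by (rule interval_exists)
      obtain U where U: "U \<epsilon> T" "\<And>z. z \<epsilon> U \<longleftrightarrow> (\<exists>c. c \<epsilon> I \<and> m_rel f z c)"
        using continuous_preimage[OF f I(2)] by blast
      have "G x U"
        unfolding G_def U(2) op_add using U(1) x I(1) n n_unique E
        unfolding m_open_interval_def by metis
      then show ?thesis by blast
    qed
  qed (auto simp: G_def)
  have ne: "m_nonempty E"
    using pos_neg_exist less_closed unfolding m_nonempty_def E by metis
  have R_on: "m_relation_on R E" by (auto simp: m_relation_on_def R Q_def)
  have R_total: "\<exists>y. y \<epsilon> E \<and> m_rel R x y" if x: "x \<epsilon> E" for x
    using half_exists less_closed x unfolding rel_R E by metis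
  obtain D W where D: "m_nonempty D" "m_subset D E" "\<And>x. x \<epsilon> D \<Longrightarrow> \<exists>y. y \<epsilon> D \<and> m_rel R x y"
    and W_open: "W \<epsilon> T" and W: "\<And>z. z \<epsilon> W \<longleftrightarrow> z \<epsilon> X \<and> (\<forall>x U. x \<epsilon> D \<and> m_rel g x U \<longrightarrow> z \<epsilon> U)"
    by (rule WDC_open_inter[OF WDC P g(1) ne R_on R_total], assumption) (rule that)
  have D_E: "x \<epsilon> E" if "x \<epsilon> D" for x using D(2) that by (simp add: m_subset_def)
  \<comment> \<open>\<open>D\<close> is closed under halving because \<open>rel_R\<close> makes any
    successor of \<open>x\<close> a half of \<open>x\<close>.\<close>
  have not_below: "\<not> zero \<prec> b" if b: "\<And>x. x \<epsilon> D \<Longrightarrow> b \<prec> x" for b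
    by (rule halving_lower_bound[OF D(1) _ _ b]) (use D_E E D(3) rel_R in blast)+
  have "Z = W"
  proof (rule ext)
    fix z
    show "z \<epsilon> Z \<longleftrightarrow> z \<epsilon> W"
    proof
      assume z: "z \<epsilon> Z"
      have "z \<epsilon> U" if xU: "x \<epsilon> D" "m_rel g x U" for x U
      proof -
        have x: "x \<epsilon> A" "zero \<prec> x" using D_E[OF xU(1)] E by blast+
        obtain n where n: "n \<epsilon> A" "x \<oplus> n = zero" using neg_exists x(1) by blast
        then have "n \<prec> zero" using add_less[OF x(2), of n] by simp
        with n x z show ?thesis using xU(2) unfolding g(2) G_def op_add Z by auto
      qed
      then show "z \<epsilon> W" using z function_toD(1)[OF fn] unfolding W Z by blast
    next
      assume z: "z \<epsilon> W"
      then obtain c where c: "m_rel f z c" using function_toD(2)[OF fn] W by blast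
      then have cA: "c \<epsilon> A" using function_toD(1)[OF fn] by blast
      have bound: "c \<prec> x \<and> (\<exists>n. n \<epsilon> A \<and> x \<oplus> n = zero \<and> n \<prec> c)" if x: "x \<epsilon> D" for x
      proof -
        obtain U where U: "m_rel g x U" using function_toD(2)[OF g(1)] D_E x by blast
        then have "z \<epsilon> U" using z x W by blast
        with U show ?thesis using function_toD(3)[OF fn c] unfolding g(2) G_def op_add by metis
      qed
      have "\<not> zero \<prec> c" using not_below bound by blast
      moreover have "\<not> c \<prec> zero"
      proof
        assume neg: "c \<prec> zero"
        obtain c' where c': "c' \<epsilon> A" "c \<oplus> c' = zero" using neg_exists cA by blast
        \<comment> \<open>From -x below \<open>c\<close>: adding \<open>c'\<close>, the inverse of
          \<open>c\<close>, and then \<open>x\<close> gives \<open>c'\<close> below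
          \<open>x\<close>. So a negative value would make \<open>c'\<close> a positive strict lower
          bound.\<close>
        have "c' \<prec> x" if x: "x \<epsilon> D" for x
        proof -
          obtain n where n: "n \<epsilon> A" "x \<oplus> n = zero" "n \<prec> c" using bound x by blast
          have xA: "x \<epsilon> A" using D_E E x by blast
          have "n \<oplus> c' \<prec> zero" using add_less[OF n(3) c'(1)] c' by simp
          from add_less[OF this xA] have "n \<oplus> c' \<oplus> x \<prec> x" using xA by simp
          moreover have "n \<oplus> c' \<oplus> x = c'"
            using add_assoc[of x n c'] add_comm[of "n \<oplus> c'" x] n c' xA by simp
          ultimately show ?thesis by simp
        qed
        moreover have "zero \<prec> c'" using add_less[OF neg c'(1)] c' by simp
        ultimately show False using not_below by blast
      qed
      ultimately have "c = zero" using less_total[OF cA, of zero] by auto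
      with c show "z \<epsilon> Z" by (simp add: Z)
    qed
  qed
  with W_open show ?thesis by simp
qed

lemma zero_set_clopen:
  assumes "m_WDC" "m_P_space X T" "m_zero_set A zero lt X T Z"
  shows "m_clopen_in X T Z"
proof -
  obtain U where U: "\<And>x. x \<epsilon> U \<longleftrightarrow> x \<epsilon> X \<and> \<not> x \<epsilon> Z"
    by (rule separation[of "\<lambda>x. \<not> x \<epsilon> Z" "[Z]" "\<^bold>\<not> 1 \<^bold>\<in> 0" X]) auto
  then have diff: "m_is_diff U X Z" by (simp add: m_is_diff_def)
  have T: "m_topology X T" using assms(2) by (simp add: m_P_space_def)
  have "Z \<epsilon> T" by (rule zero_set_open[OF assms])
  moreover from this have "m_subset Z X" using topologyD(1)[OF T] unfolding m_subset_def by blast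
  ultimately show ?thesis
    using diff complement_zero_set_open[OF assms(3) diff] unfolding m_clopen_in_def m_closed_in_def
    by blast
qed

lemma regular_P_space_completely_regular:
  "m_WDC \<Longrightarrow> m_regular X T \<Longrightarrow> m_P_space X T \<Longrightarrow> m_completely_regular A zero lt X T"
  by (intro zero_dimensional_completely_regular regular_P_space_zero_dimensional)

text \<open>The first of two disjoint zero-sets is itself clopen and separates them.\<close>

lemma regular_P_space_strongly_zero_dimensional:
  assumes "m_WDC" "m_regular X T" "m_P_space X T"
  shows "m_strongly_zero_dimensional A zero lt X T"
  unfolding m_strongly_zero_dimensional_def
proof (intro conjI allI impI)
  show "m_completely_regular A zero lt X T"
    using assms by (rule regular_P_space_completely_regular)
  fix Z Z'
  assume *: "m_zero_set A zero lt X T Z \<and> m_zero_set A zero lt X T Z' \<and> m_disjoint Z Z'"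
  then have Z: "m_clopen_in X T Z" using zero_set_clopen[OF assms(1,3)] by blast
  obtain D where D: "\<And>x. x \<epsilon> D \<longleftrightarrow> x \<epsilon> X \<and> \<not> x \<epsilon> Z'"
    by (rule separation[of "\<lambda>x. \<not> x \<epsilon> Z'" "[Z']" "\<^bold>\<not> 1 \<^bold>\<in> 0" X]) auto
  have "m_subset Z D"
    using Z * unfolding m_clopen_in_def m_closed_in_def m_subset_def m_disjoint_def D by blast
  moreover have "m_is_diff D X Z'" using D by (simp add: m_is_diff_def)
  moreover have "m_subset Z Z" by (simp add: m_subset_def)
  ultimately show "\<exists>U D. m_clopen_in X T U \<and> m_is_diff D X Z' \<and> m_subset Z U \<and> m_subset U D"
    using Z by blast
qed

end

lemma (in zf) zf_reals_if: "m_is_reals A add mul zero one lt \<Longrightarrow> zf_reals (\<epsilon>) A add mul zero one lt"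
  by unfold_locales

theorem theorem4p14:
  "(ZF \<^bold>\<turnstile> WDC \<^bold>\<longrightarrow> (\<^bold>\<forall>X T. regular X T \<^bold>\<and> P_space X T \<^bold>\<longrightarrow> zero_dimensional X T)) \<and>
   (ZF \<^bold>\<turnstile> WDC \<^bold>\<longrightarrow> (\<^bold>\<forall>A add mul zero one lt. is_reals A add mul zero one lt \<^bold>\<longrightarrow>
      (\<^bold>\<forall>X T. regular X T \<^bold>\<and> P_space X T \<^bold>\<longrightarrow> completely_regular A zero lt X T))) \<and>
   (ZF \<^bold>\<turnstile> WDC \<^bold>\<longrightarrow> (\<^bold>\<forall>A add mul zero one lt. is_reals A add mul zero one lt \<^bold>\<longrightarrow>
      (\<^bold>\<forall>X T. regular X T \<^bold>\<and> P_space X T \<^bold>\<longrightarrow> strongly_zero_dimensional A zero lt X T))) \<and>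
   (ZF \<^bold>\<turnstile> WDC \<^bold>\<longrightarrow> (\<^bold>\<forall>A add mul zero one lt. is_reals A add mul zero one lt \<^bold>\<longrightarrow>
      (\<^bold>\<forall>X T. regular X T \<^bold>\<and> P_space X T \<^bold>\<longrightarrow>
        (zero_dimensional X T \<^bold>\<longleftrightarrow> completely_regular A zero lt X T))))"
proof (intro conjI; rule ZF_proves)
  fix mem :: "nat \<Rightarrow> nat \<Rightarrow> bool" and e
  assume "zf mem"
  then interpret zf mem .
  show "holds mem e [] (WDC \<^bold>\<longrightarrow> (\<^bold>\<forall>X T. regular X T \<^bold>\<and> P_space X T \<^bold>\<longrightarrow> zero_dimensional X T))"
    by (simp add: regular_P_space_zero_dimensional)
next
  fix mem :: "nat \<Rightarrow> nat \<Rightarrow> bool" and e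
  assume "zf mem"
  then interpret zf mem .
  show "holds mem e [] (WDC \<^bold>\<longrightarrow> (\<^bold>\<forall>A add mul zero one lt. is_reals A add mul zero one lt \<^bold>\<longrightarrow>
    (\<^bold>\<forall>X T. regular X T \<^bold>\<and> P_space X T \<^bold>\<longrightarrow> completely_regular A zero lt X T)))"
    by (simp add: zf_reals.regular_P_space_completely_regular[OF zf_reals_if])
next
  fix mem :: "nat \<Rightarrow> nat \<Rightarrow> bool" and e
  assume "zf mem"
  then interpret zf mem .
  show "holds mem e [] (WDC \<^bold>\<longrightarrow> (\<^bold>\<forall>A add mul zero one lt. is_reals A add mul zero one lt \<^bold>\<longrightarrow>
    (\<^bold>\<forall>X T. regular X T \<^bold>\<and> P_space X T \<^bold>\<longrightarrow> strongly_zero_dimensional A zero lt X T)))"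
    by (simp add: zf_reals.regular_P_space_strongly_zero_dimensional[OF zf_reals_if])
next
  fix mem :: "nat \<Rightarrow> nat \<Rightarrow> bool" and e
  assume "zf mem"
  then interpret zf mem .
  show "holds mem e [] (WDC \<^bold>\<longrightarrow> (\<^bold>\<forall>A add mul zero one lt. is_reals A add mul zero one lt \<^bold>\<longrightarrow>
    (\<^bold>\<forall>X T. regular X T \<^bold>\<and> P_space X T \<^bold>\<longrightarrow>
      (zero_dimensional X T \<^bold>\<longleftrightarrow> completely_regular A zero lt X T))))"
    \<comment> \<open>Both sides of the equivalence hold outright under WDC.\<close>
    by (simp add: regular_P_space_zero_dimensional
        zf_reals.regular_P_space_completely_regular[OF zf_reals_if])
qed

end
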